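(* Let $\bm{A}\in\mathbb{Z}^{m\times n}$ be a matrix of full column rank with $\Delta(\bm{A})\le 2$, and suppose the cone $C(\bm{A})=\{\bm{x}\in\mathbb{R}^n:\bm{A}\bm{x}\ge\bm{0}\}$ is $n$-dimensional. Then $\operatorname{CR}(C(\bm{A}))=n$.
   Context: For $\bm{A}\in\mathbb{Z}^{m\times n}$ of full column rank, $\Delta(\bm{A})=\max\{|\det\bm{B}|:\bm{B}\text{ an }n\times n\text{ submatrix of }\bm{A}\}$. The cone $C(\bm{A})$ is then rational and pointed. For a rational pointed cone $C$, the semigroup $C\cap\mathbb{Z}^n$ has a unique inclusion-minimal finite generating set $H(C)$ (every integer point of $C$ is a non-negative integer combination of its elements), the Hilbert basis. For $\bm{x}\in C\cap\mathbb{Z}^n$, $\sigma(\bm{x})=\min\{l:\bm{x}=\lambda_1\bm{h}_1+\cdots+\lambda_l\bm{h}_l,\ \lambda_i\in\mathbb{Z}_{\ge0},\ \bm{h}_i\in H(C)\}$, and the integer Carathéodory rank is $\operatorname{CR}(C)=\max\{\sigma(\bm{x}):\bm{x}\in C\cap\mathbb{Z}^n\}$. *)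

theory Defs
  imports "HOL-Analysis.Analysis"
begin

definition real_matrix :: "int ^ 'n ^ 'm \<Rightarrow> real ^ 'n ^ 'm" where
  "real_matrix A = (\<chi> i j. real_of_int (A $ i $ j))"

definition full_column_rank :: "int ^ 'n ^ 'm \<Rightarrow> bool" where
  "full_column_rank A \<longleftrightarrow> rank (real_matrix A) = CARD('n)"

(* An n x n submatrix is given by an injective choice of rows; the order in which the rows are
   listed only affects the sign of the determinant. The set below is finite, and it is nonempty
   whenever A has full column rank. *)
definition Delta :: "int ^ 'n ^ 'm \<Rightarrow> int" where
  "Delta A = Max {\<bar>det (\<chi> i j. A $ r i $ j)\<bar> | r :: 'n \<Rightarrow> 'm. inj r}"

definition matrix_cone :: "int ^ 'n ^ 'm \<Rightarrow> (real ^ 'n) set" where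
  "matrix_cone A = {x. \<forall>i. (real_matrix A *v x) $ i \<ge> 0}"

definition int_points :: "(real ^ 'n) set \<Rightarrow> (real ^ 'n) set" where
  "int_points C = {x \<in> C. \<forall>i. x $ i \<in> \<int>}"

definition generates :: "(real ^ 'n) set \<Rightarrow> (real ^ 'n) set \<Rightarrow> bool" where
  "generates H C \<longleftrightarrow> finite H \<and> H \<subseteq> int_points C \<and>
     (\<forall>x \<in> int_points C. \<exists>c :: real ^ 'n \<Rightarrow> nat. x = (\<Sum>h\<in>H. real (c h) *\<^sub>R h))"

(* Meaningful for rational pointed cones C, where the inclusion-minimal finite generating set of
   the integer points exists and is unique. *)
definition hilbert_basis :: "(real ^ 'n) set \<Rightarrow> (real ^ 'n) set" where
  "hilbert_basis C =
     (THE H. generates H C \<and> (\<forall>H'. generates H' C \<longrightarrow> H' \<subseteq> H \<longrightarrow> H' = H))"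

definition hilbert_length :: "(real ^ 'n) set \<Rightarrow> real ^ 'n \<Rightarrow> nat" where
  "hilbert_length C x =
     (LEAST l. \<exists>(h :: nat \<Rightarrow> real ^ 'n) (c :: nat \<Rightarrow> nat).
        (\<forall>i<l. h i \<in> hilbert_basis C) \<and> x = (\<Sum>i<l. real (c i) *\<^sub>R h i))"

(* The maximum is over a finite set for rational pointed C, since every hilbert_length is at most
   the cardinality of the Hilbert basis. *)
definition caratheodory_rank :: "(real ^ 'n) set \<Rightarrow> nat" where
  "caratheodory_rank C = Max (hilbert_length C ` int_points C)"

end

theory Submission
  imports Defs
begin

text \<open>Given a nonzero integer point \<open>x\<close> of the cone, let \<open>J\<close> be the set of rows vanishing at \<open>x\<close>
  and \<open>c\<^sub>i \<in> {1, 2}\<close> the content of row \<open>i\<close> on the lattice of integer points of \<open>ker J\<close>. There is a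
  nonzero integer point \<open>h\<close> in the same face with \<open>a\<^sub>i \<bullet> h \<in> {0, c\<^sub>i}\<close> for all \<open>i\<close>: scale a generic
  point \<open>y\<close> of the relative interior of the face so that the largest of the values \<open>a\<^sub>i \<bullet> y / c\<^sub>i\<close>,
  say for \<open>i = k\<close>, is 1; all other bounds \<open>0 \<le> a\<^sub>i \<bullet> y \<le> c\<^sub>i\<close> are then strict unless row \<open>i\<close> is
  proportional to row \<open>k\<close> on \<open>ker J\<close>, so the polytope cut out by them in \<open>a\<^sub>k \<bullet> y = c\<^sub>k\<close> is full-dimensional there and contains an integer point by a theorem of
  Veselov and Chirkov on matrices with \<open>\<Delta> \<le> 2\<close>. An irreducible \<open>g \<le> h\<close> has the same property,
  and since \<open>c\<^sub>i\<close> divides \<open>a\<^sub>i \<bullet> x\<close>, the largest \<open>\<lambda>\<close> for which \<open>x - \<lambda> g\<close> stays in the cone is an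
  integer, and \<open>x - \<lambda> g\<close> lies on a smaller face. So at most \<open>n\<close> elements suffice. Conversely,
  the integer points using fewer than \<open>n\<close> elements lie in finitely many proper subspaces.\<close>

section \<open>Lattices of index at most 2\<close>

definition int_vec :: "real ^ 'n \<Rightarrow> bool" where
  "int_vec y \<longleftrightarrow> (\<forall>k. y $ k \<in> \<int>)"

lemma int_vec_0 [simp]: "int_vec 0"
  and int_vec_add: "int_vec x \<Longrightarrow> int_vec y \<Longrightarrow> int_vec (x + y)"
  and int_vec_diff: "int_vec x \<Longrightarrow> int_vec y \<Longrightarrow> int_vec (x - y)"
  and int_vec_scaleR: "c \<in> \<int> \<Longrightarrow> int_vec x \<Longrightarrow> int_vec (c *\<^sub>R x)"
  by (auto simp: int_vec_def)

lemma int_vec_inner: "int_vec x \<Longrightarrow> int_vec y \<Longrightarrow> x \<bullet> y \<in> \<int>"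
  by (auto simp: int_vec_def inner_vec_def intro!: Ints_sum)

lemma Ints_det:
  fixes M :: "real ^ 'n ^ 'n"
  assumes "\<And>k. int_vec (M $ k)"
  shows "det M \<in> \<int>"
  using assms by (auto simp: det_def int_vec_def intro!: Ints_sum Ints_mult Ints_prod)

text \<open>By Cramer's rule the product is the determinant of the integer matrix that has
  \<open>M *v y\<close> as its column \<open>c\<close>.\<close>

lemma Ints_det_times_component:
  fixes M :: "real ^ 'n ^ 'n"
  assumes "\<And>k. int_vec (M $ k)" "int_vec (M *v y)"
  shows "det M * y $ c \<in> \<int>"
proof -
  have "det (\<chi> i j. if j = c then (M *v y) $ i else M $ i $ j) \<in> \<int>"
    using assms by (intro Ints_det) (auto simp: int_vec_def)
  then show ?thesis
    by (simp add: cramer_lemma mult.commute)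
qed

text \<open>Cramer's rule for the matrix obtained from \<open>M\<close> by replacing column \<open>a\<close> with \<open>M *v y\<close>.\<close>
lemma Ints_det_times_minor:
  fixes M :: "real ^ 'n ^ 'n"
  assumes M: "\<And>k. int_vec (M $ k)" and My: "int_vec (M *v y)" and Mz: "int_vec (M *v z)"
    and ya: "y $ a \<noteq> 0"
  shows "det M * (y $ a * z $ c - z $ a * y $ c) \<in> \<int>"
proof (cases "c = a")
  case False
  define M' where "M' = (\<chi> i j. if j = a then (M *v y) $ i else M $ i $ j)"
  define t where "t = z $ a / y $ a"
  \<comment> \<open>\<open>z - t *\<^sub>R y\<close> has no component at \<open>a\<close>, so
    \<open>M'\<close> acts on it as \<open>M\<close>; since \<open>M'\<close> sends
    \<open>axis a 1\<close> to \<open>M *v y\<close>, the last summand restores what was subtracted.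
    Thus \<open>M' *v w = M *v z\<close>.\<close>
  define w where "w = z - t *\<^sub>R y + t *\<^sub>R axis a 1"
  have M'v: "M' *v v = M *v v" if "v $ a = 0" for v
    unfolding matrix_vector_mult_def M'_def vec_eq_iff using that
    by (auto intro!: sum.cong)
  have "M' *v axis a 1 = M *v y"
    by (simp add: vec_eq_iff matrix_vector_mult_basis column_def M'_def)
  moreover have "(z - t *\<^sub>R y) $ a = 0"
    using ya by (simp add: t_def)
  ultimately have "M' *v w = M *v (z - t *\<^sub>R y) + t *\<^sub>R (M *v y)"
    by (simp add: w_def M'v matrix_vector_right_distrib scaleR_matrix_vector_assoc
        matrix_vector_mult_scaleR)
  then have "M' *v w = M *v z"
    by (simp add: matrix_vector_mult_diff_distrib matrix_vector_mult_scaleR)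
  then have "det M' * w $ c \<in> \<int>"
    using M My Mz by (intro Ints_det_times_component) (auto simp: M'_def int_vec_def)
  moreover have "det M' = y $ a * det M"
    unfolding M'_def by (rule cramer_lemma)
  moreover have "y $ a * w $ c = y $ a * z $ c - z $ a * y $ c"
    using False ya by (simp add: w_def axis_def t_def field_simps)
  ultimately show ?thesis
    by (metis mult.assoc mult.commute)
qed simp

text \<open>Cramer's rule makes \<open>det M * y $ c\<close> an integer, so determinant 1 or -1
  would force \<open>y\<close> to be integral; what remains is 2 or -2.\<close>

lemma half_integral_if_det_le_2:
  fixes M :: "real ^ 'n ^ 'n"
  assumes M: "\<And>k. int_vec (M $ k)" and My: "int_vec (M *v y)"
    and d: "det M \<noteq> 0" "\<bar>det M\<bar> \<le> 2" and ny: "\<not> int_vec y"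
  shows "\<bar>det M\<bar> = 2" "int_vec (2 *\<^sub>R y)"
proof -
  obtain D :: int where D: "det M = of_int D"
    using Ints_det[OF M] by (auto elim: Ints_cases)
  have *: "det M * y $ c \<in> \<int>" for c
    by (rule Ints_det_times_component[OF M My])
  have "\<bar>D\<bar> \<le> 2" "D \<noteq> 0"
    using d unfolding D by linarith+
  moreover have "\<bar>D\<bar> \<noteq> 1"
  proof
    assume "\<bar>D\<bar> = 1"
    then have "D = 1 \<or> D = -1" by linarith
    then have "y $ c \<in> \<int>" for c
      using *[of c] D by (auto simp: minus_in_Ints_iff)
    with ny show False by (simp add: int_vec_def)
  qed
  ultimately have "D = 2 \<or> D = -2" by linarith
  then show "\<bar>det M\<bar> = 2" "int_vec (2 *\<^sub>R y)"
    using * by (auto simp: D int_vec_def minus_in_Ints_iff)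
qed

text \<open>The vectors with integral image under \<open>M\<close> form a lattice in which the integer vectors
  have index \<open>\<bar>det M\<bar> \<le> 2\<close>.\<close>
lemma int_vec_add_if_det_le_2:
  fixes M :: "real ^ 'n ^ 'n"
  assumes M: "\<And>k. int_vec (M $ k)" and My: "int_vec (M *v y)" and Mz: "int_vec (M *v z)"
    and d: "det M \<noteq> 0" "\<bar>det M\<bar> \<le> 2" and ny: "\<not> int_vec y" and nz: "\<not> int_vec z"
  shows "int_vec (y + z)"
proof -
  note y = half_integral_if_det_le_2[OF M My d ny]
  note z = half_integral_if_det_le_2[OF M Mz d nz]
  have y2: "2 * y $ c \<in> \<int>" and z2: "2 * z $ c \<in> \<int>" for c
    using y(2) z(2) by (auto simp: int_vec_def)
  obtain a where a: "y $ a \<notin> \<int>" using ny by (auto simp: int_vec_def)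
  have minor: "2 * (y $ a * z $ c - z $ a * y $ c) \<in> \<int>" for c
  proof -
    have "det M = 2 \<or> det M = -2" using y(1) by linarith
    moreover have "y $ a \<noteq> 0" using a by auto
    ultimately have "2 * (y $ a * z $ c - z $ a * y $ c) \<in> \<int> \<or> - (2 * (y $ a * z $ c - z $ a * y $ c)) \<in> \<int>"
      using Ints_det_times_minor[OF M My Mz, of a c] by auto
    then show ?thesis by (simp only: minus_in_Ints_iff) simp
  qed
  obtain Y Z :: "'n \<Rightarrow> int" where Y: "\<And>c. 2 * y $ c = of_int (Y c)" and Z: "\<And>c. 2 * z $ c = of_int (Z c)"
    using y2 z2 unfolding Ints_def image_iff by metis
  \<comment> \<open>As \<open>Y a\<close> turns out to be odd, even minors mean that the parity
    vectors of \<open>Y\<close> and \<open>Z\<close> are dependent over the two-element field.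
    Neither is zero, so they coincide and \<open>Y c + Z c\<close> is always even.\<close>
  have even_minor: "even (Y a * Z c - Z a * Y c)" for c
  proof -
    obtain q :: int where "2 * (y $ a * z $ c - z $ a * y $ c) = of_int q"
      using minor[of c] by (auto elim: Ints_cases)
    then have "(2 * y $ a) * (2 * z $ c) - (2 * z $ a) * (2 * y $ c) = 2 * of_int q"
      by (simp add: algebra_simps)
    then have "real_of_int (Y a * Z c - Z a * Y c) = of_int (2 * q)"
      by (simp only: Y Z of_int_mult of_int_diff of_int_numeral)
    then show ?thesis by (metis dvd_triv_left of_int_eq_iff)
  qed
  have half: "u \<in> \<int>" if "2 * u = real_of_int q" "even q" for u :: real and q
    using that by (elim evenE) simp
  have "odd (Y a)" using half[OF Y] a by blast
  moreover obtain c where "z $ c \<notin> \<int>" using nz by (auto simp: int_vec_def)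
  then have "odd (Z c)" using half[OF Z] by blast
  ultimately have "odd (Z a)" using even_minor[of c] by auto
  have "(y + z) $ c \<in> \<int>" for c
  proof (rule half)
    show "2 * (y + z) $ c = of_int (Y c + Z c)" using Y[of c] Z[of c] by simp
    show "even (Y c + Z c)" using even_minor[of c] \<open>odd (Y a)\<close> \<open>odd (Z a)\<close> by auto
  qed
  then show ?thesis by (simp add: int_vec_def)
qed

section \<open>Generic points and vertices\<close>

lemma eventually_affine_neq_0:
  fixes c d :: real
  assumes "d \<noteq> 0"
  shows "eventually (\<lambda>n. real n * c + d \<noteq> 0) sequentially"
proof (cases "c = 0")
  case False
  have "real n * c + d \<noteq> 0" if "n > nat \<lceil>- d / c\<rceil>" for n
  proof
    assume "real n * c + d = 0"
    then have "real n = - d / c" using False by (simp add: field_simps)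
    with that show False by linarith
  qed
  then show ?thesis
    by (rule eventually_mono[OF eventually_gt_at_top])
qed (use assms in simp)

lemma scaleR_add_closed:
  fixes S :: "'a::real_vector set"
  assumes add: "\<And>x y. x \<in> S \<Longrightarrow> y \<in> S \<Longrightarrow> x + y \<in> S" and s: "s \<in> S" and v: "v \<in> S"
  shows "real n *\<^sub>R s + v \<in> S"
proof (induction n)
  case (Suc n)
  have "s + (real n *\<^sub>R s + v) \<in> S" by (rule add[OF s Suc])
  then show ?case by (simp add: scaleR_add_left add.assoc)
qed (use v in simp)

text \<open>Induction on the functionals: a large multiple of a point where the new one is nonzero
  is added to a point that is good for the old ones. Closure under addition suffices for this, so it
  applies to subspaces, relatively open cones and monoids of integer points alike.\<close>

lemma generic_element:
  fixes S :: "'a::real_inner set"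
  assumes add: "\<And>x y. x \<in> S \<Longrightarrow> y \<in> S \<Longrightarrow> x + y \<in> S" and ne: "S \<noteq> {}"
    and fin: "finite \<Phi>" and nz: "\<And>\<phi>. \<phi> \<in> \<Phi> \<Longrightarrow> \<exists>s\<in>S. \<phi> \<bullet> s \<noteq> 0"
  obtains s where "s \<in> S" "\<And>\<phi>. \<phi> \<in> \<Phi> \<Longrightarrow> \<phi> \<bullet> s \<noteq> 0"
proof -
  have "\<exists>s\<in>S. \<forall>\<phi>\<in>\<Phi>. \<phi> \<bullet> s \<noteq> 0"
    using fin nz
  proof (induction \<Phi>)
    case (insert \<psi> \<Phi>)
    then obtain s where s: "s \<in> S" "\<forall>\<phi>\<in>\<Phi>. \<phi> \<bullet> s \<noteq> 0" by blast
    obtain t where t: "t \<in> S" "\<psi> \<bullet> t \<noteq> 0" using insert by blast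
    have "eventually (\<lambda>n. \<forall>\<phi>\<in>\<Phi>. real n * (\<phi> \<bullet> t) + \<phi> \<bullet> s \<noteq> 0) sequentially"
      using insert.hyps(1) s(2) by (intro eventually_ball_finite ballI eventually_affine_neq_0) auto
    moreover have "eventually (\<lambda>n. real n * (\<psi> \<bullet> t) + \<psi> \<bullet> s \<noteq> 0) sequentially"
    proof (cases "\<psi> \<bullet> s = 0")
      case True
      show ?thesis
        by (rule eventually_mono[OF eventually_gt_at_top[of 0]]) (use True t(2) in simp)
    qed (rule eventually_affine_neq_0)
    ultimately have "eventually (\<lambda>n. \<forall>\<phi>\<in>insert \<psi> \<Phi>. real n * (\<phi> \<bullet> t) + \<phi> \<bullet> s \<noteq> 0) sequentially"
      by eventually_elim blast
    then obtain n where n: "\<forall>\<phi>\<in>insert \<psi> \<Phi>. real n * (\<phi> \<bullet> t) + \<phi> \<bullet> s \<noteq> 0"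
      using eventually_happens'[OF sequentially_bot] by blast
    have "real n *\<^sub>R t + s \<in> S" by (rule scaleR_add_closed[OF add t(1) s(1)])
    moreover have "\<forall>\<phi>\<in>insert \<psi> \<Phi>. \<phi> \<bullet> (real n *\<^sub>R t + s) \<noteq> 0"
      using n by (simp add: inner_add_right)
    ultimately show ?case by blast
  qed (use ne in auto)
  then show thesis using that by blast
qed

section \<open>Kernels and slabs of a system of rows\<close>

locale row_system =
  fixes a :: "'m::finite \<Rightarrow> real ^ 'n"
  assumes eq_0_if_orthogonal: "(\<And>i. a i \<bullet> y = 0) \<Longrightarrow> y = 0"
begin

definition ker :: "'m set \<Rightarrow> (real ^ 'n) set" where
  "ker J = {y. \<forall>j\<in>J. a j \<bullet> y = 0}"

definition slab :: "('m \<Rightarrow> real) \<Rightarrow> ('m \<Rightarrow> real) \<Rightarrow> (real ^ 'n) set" where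
  "slab l u = {y. \<forall>i. l i \<le> a i \<bullet> y \<and> a i \<bullet> y \<le> u i}"

lemma subspace_ker: "subspace (ker J)"
  unfolding ker_def subspace_def by (auto simp: inner_add_right)

text \<open>A basis of the rows in \<open>J\<close> is extended first by \<open>a i\<close> and then
  by rows of \<open>K\<close> to a basis of the whole space. The last conclusion holds because the
  chosen rows from \<open>J\<close> still span all rows in \<open>J\<close>.\<close>

lemma basis_rows:
  assumes v: "v \<in> ker J" "a i \<bullet> v \<noteq> 0" and K: "ker K = {0}" "insert i J \<subseteq> K"
  obtains r :: "'n \<Rightarrow> 'm" where "inj r" "range r \<subseteq> K" "i \<in> range r"
    "det (\<chi> k. a (r k)) \<noteq> 0" "\<And>y. (\<And>k. r k \<in> J \<Longrightarrow> a (r k) \<bullet> y = 0) \<Longrightarrow> y \<in> ker J"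
proof -
  obtain B0 where B0: "B0 \<subseteq> a ` J" "independent B0" "a ` J \<subseteq> span B0"
    using maximal_independent_subset[of "a ` J"] by blast
  have orth: "\<forall>b\<in>X. b \<bullet> y = 0 \<Longrightarrow> x \<in> span X \<Longrightarrow> x \<bullet> y = 0" for X and x y :: "real ^ 'n"
    by (metis orthogonal_commute orthogonal_def orthogonal_to_span)
  have "a i \<notin> span B0"
  proof
    assume "a i \<in> span B0"
    then have "a i \<bullet> v = 0" using v(1) B0(1) by (intro orth[of B0]) (auto simp: ker_def)
    with v(2) show False by simp
  qed
  then have ind: "independent (insert (a i) B0)"
    using B0(2) by (simp add: independent_insert)
  obtain B where B: "insert (a i) B0 \<subseteq> B" "B \<subseteq> a ` K" "independent B" "a ` K \<subseteq> span B"
    using maximal_independent_subset_extend[OF _ ind, of "a ` K"] B0(1) K(2) by blast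
  have B_orth: "y = 0" if "\<forall>b\<in>B. b \<bullet> y = 0" for y
  proof -
    have "y \<in> ker K" using orth[OF that] B(4) by (auto simp: ker_def)
    with K(1) show ?thesis by simp
  qed
  have "span B = UNIV"
  proof (rule ccontr)
    assume "span B \<noteq> UNIV"
    from span_not_UNIV_orthogonal[OF this] obtain w where "w \<noteq> 0" "\<forall>x\<in>span B. w \<bullet> x = 0" by blast
    then show False using B_orth[of w] by (metis inner_commute span_base)
  qed
  then have "card B = CARD('n)"
    using basis_card_eq_dim[OF subset_UNIV _ B(3)] by simp
  moreover have "finite B" using B(3) by (rule independent_imp_finite)
  ultimately obtain g :: "'n \<Rightarrow> real ^ 'n" where g: "bij_betw g UNIV B"
    by (metis finite bij_betw_iff_card)
  \<comment> \<open>Equal rows may occur at several indices. Index \<open>i\<close> has priority so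
    that it lies in \<open>range r\<close>; rows of \<open>B0\<close> get an index in
    \<open>J\<close>, as the last conclusion needs.\<close>
  define f where "f b = (if b = a i then i else if b \<in> B0 then (SOME j. j \<in> J \<and> a j = b)
     else (SOME k. k \<in> K \<and> a k = b))" for b
  have f_J: "f b \<in> J \<and> a (f b) = b" if "b \<in> B0" for b
  proof -
    have "b \<noteq> a i" using that \<open>a i \<notin> span B0\<close> span_base by metis
    moreover have "\<exists>j. j \<in> J \<and> a j = b" using B0(1) that by blast
    ultimately show ?thesis unfolding f_def using that by (simp, intro someI_ex[of "\<lambda>j. j \<in> J \<and> a j = b"])
  qed
  have f: "f b \<in> K \<and> a (f b) = b" if "b \<in> B" for b
  proof -
    consider "b = a i" | "b \<in> B0" | "b \<noteq> a i" "b \<notin> B0" by blast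
    then show ?thesis
    proof cases
      case 1
      then show ?thesis using K(2) by (simp add: f_def)
    next
      case 2
      with f_J[OF 2] K(2) show ?thesis by blast
    next
      case 3
      have "\<exists>k. k \<in> K \<and> a k = b" using B(2) that by blast
      from someI_ex[OF this] show ?thesis using 3 by (simp add: f_def)
    qed
  qed
  define r where "r = f \<circ> g"
  have gB: "g k \<in> B" for k using g by (auto simp: bij_betw_def)
  have ar: "a (r k) = g k" for k using f[OF gB] by (simp add: r_def)
  show thesis
  proof (rule that)
    show "inj r"
    proof (rule injI)
      fix x y assume "r x = r y"
      then have "g x = g y" by (metis ar)
      with g show "x = y" by (auto simp: bij_betw_def inj_def)
    qed
    show "range r \<subseteq> K" using f gB by (auto simp: r_def)
    obtain k where "g k = a i" using g B(1) by (metis bij_betw_imp_surj_on imageE insert_subset)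
    then have "r k = i" by (simp add: r_def f_def)
    then show "i \<in> range r" by blast
    let ?M = "\<chi> k. a (r k)"
    have "y = 0" if "?M *v y = 0" for y
    proof (rule B_orth, intro ballI)
      fix b assume "b \<in> B"
      then obtain k where "g k = b" using g by (metis bij_betw_imp_surj_on imageE)
      moreover have "(?M *v y) $ k = 0" using that by simp
      ultimately show "b \<bullet> y = 0" by (simp add: matrix_vector_mul_component ar)
    qed
    then have "\<exists>N. N ** ?M = mat 1" by (simp add: matrix_left_invertible_ker)
    then have "invertible ?M" by (simp add: invertible_left_inverse)
    then show "det ?M \<noteq> 0" by (simp add: invertible_det_nz)
    show "y \<in> ker J" if y: "\<And>k. r k \<in> J \<Longrightarrow> a (r k) \<bullet> y = 0" for y
    proof -
      have "b \<bullet> y = 0" if "b \<in> B0" for b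
      proof -
        have "b \<in> B" using B(1) that by blast
        then obtain k where k: "g k = b" using g by (metis bij_betw_imp_surj_on imageE)
        then have "r k \<in> J" using f_J[OF that] by (simp add: r_def)
        from y[OF this] show ?thesis by (simp add: ar k)
      qed
      then show ?thesis using orth[of B0 y] B0(3) by (auto simp: ker_def)
    qed
  qed
qed

text \<open>The point moves along \<open>v\<close> up to the first bound that it meets; row
  \<open>k0\<close> guarantees that there is one.\<close>

lemma slab_exit:
  assumes y: "y \<in> slab l u" and k0: "a k0 \<bullet> v \<noteq> 0"
  obtains t k where "t \<ge> 0" "y + t *\<^sub>R v \<in> slab l u" "a k \<bullet> v \<noteq> 0"
    "a k \<bullet> (y + t *\<^sub>R v) \<in> {l k, u k}"
    "(\<And>k. a k \<bullet> v \<noteq> 0 \<Longrightarrow> l k < a k \<bullet> y \<and> a k \<bullet> y < u k) \<Longrightarrow> t > 0"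
proof -
  define K where "K = {k. a k \<bullet> v \<noteq> 0}"
  \<comment> \<open>The time at which row \<open>k\<close> reaches the bound it moves
    towards.\<close>
  define \<tau> where "\<tau> k = ((if a k \<bullet> v > 0 then u k else l k) - a k \<bullet> y) / (a k \<bullet> v)" for k
  define t where "t = Min (\<tau> ` K)"
  have K: "finite (\<tau> ` K)" "\<tau> ` K \<noteq> {}" using k0 by (auto simp: K_def)
  obtain k where k: "k \<in> K" "t = \<tau> k" using Min_in[OF K] by (auto simp: t_def)
  have yk: "l k \<le> a k \<bullet> y" "a k \<bullet> y \<le> u k" for k using y by (auto simp: slab_def)
  have le: "t \<le> \<tau> k" if "k \<in> K" for k using that K(1) by (simp add: t_def)
  have pos: "\<tau> k \<ge> 0" for k
    using yk[of k] by (cases "a k \<bullet> v > 0") (auto simp: \<tau>_def intro!: divide_nonneg_nonneg divide_nonpos_nonpos)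
  show thesis
  proof (rule that)
    show t0: "t \<ge> 0" using pos k by simp
    show "y + t *\<^sub>R v \<in> slab l u"
      unfolding slab_def
    proof (intro CollectI allI)
      fix k
      consider "a k \<bullet> v = 0" | "a k \<bullet> v > 0" | "a k \<bullet> v < 0" by linarith
      then show "l k \<le> a k \<bullet> (y + t *\<^sub>R v) \<and> a k \<bullet> (y + t *\<^sub>R v) \<le> u k"
      proof cases
        case 2
        then have "t \<le> (u k - a k \<bullet> y) / (a k \<bullet> v)" using le[of k] by (simp add: K_def \<tau>_def)
        then have "t * (a k \<bullet> v) \<le> u k - a k \<bullet> y" using 2 by (simp add: pos_le_divide_eq)
        moreover have "t * (a k \<bullet> v) \<ge> 0" using 2 t0 by simp
        ultimately show ?thesis using yk[of k] by (simp add: inner_add_right)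
      next
        case 3
        then have "t \<le> (l k - a k \<bullet> y) / (a k \<bullet> v)" using le[of k] by (simp add: K_def \<tau>_def)
        then have "t * (a k \<bullet> v) \<ge> l k - a k \<bullet> y" using 3 by (simp add: neg_le_divide_eq)
        moreover have "t * (a k \<bullet> v) \<le> 0" using 3 t0 by (simp add: mult_nonneg_nonpos)
        ultimately show ?thesis using yk[of k] by (simp add: inner_add_right)
      qed (use yk in \<open>simp add: inner_add_right\<close>)
    qed
    show "a k \<bullet> v \<noteq> 0" using k by (simp add: K_def)
    then show "a k \<bullet> (y + t *\<^sub>R v) \<in> {l k, u k}"
      by (simp add: k \<tau>_def inner_add_right)
    show "t > 0" if "\<And>k. a k \<bullet> v \<noteq> 0 \<Longrightarrow> l k < a k \<bullet> y \<and> a k \<bullet> y < u k"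
      using that[OF \<open>a k \<bullet> v \<noteq> 0\<close>] \<open>a k \<bullet> v \<noteq> 0\<close>
      by (auto simp: k \<tau>_def divide_pos_pos divide_neg_neg)
  qed
qed

text \<open>Among the points of the slab with objective value at most \<open>f \<bullet> y\<close>,
  one with the most tight rows is a vertex: a nonzero \<open>v\<close> orthogonal to its tight rows,
  with the sign chosen so that \<open>f\<close> does not increase, would lead by
  \<open>slab_exit\<close> to one more tight row.\<close>

lemma slab_vertex:
  assumes "y \<in> slab l u"
  obtains w where "w \<in> slab l u" "f \<bullet> w \<le> f \<bullet> y" "ker {k. a k \<bullet> w \<in> {l k, u k}} = {0}"
proof -
  define T where "T w = {k. a k \<bullet> w \<in> {l k, u k}}" for w
  define good where "good w \<longleftrightarrow> w \<in> slab l u \<and> f \<bullet> w \<le> f \<bullet> y" for w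
  have "good y" using assms by (simp add: good_def)
  moreover have "card (T w) \<le> CARD('m)" for w by (simp add: card_mono)
  ultimately obtain w where w: "good w" "\<And>w'. good w' \<Longrightarrow> card (T w') \<le> card (T w)"
    using ex_has_greatest_nat[of good y "\<lambda>w. card (T w)" "CARD('m) + 1"] by (metis le_imp_less_Suc Suc_eq_plus1)
  have "v = 0" if v: "v \<in> ker (T w)" for v
  proof (rule ccontr)
    assume "v \<noteq> 0"
    define v' where "v' = (if f \<bullet> v \<le> 0 then v else - v)"
    have "v' \<noteq> 0" "f \<bullet> v' \<le> 0" and v': "v' \<in> ker (T w)"
      using \<open>v \<noteq> 0\<close> v subspace_neg[OF subspace_ker] by (auto simp: v'_def)
    then obtain k0 where "a k0 \<bullet> v' \<noteq> 0" using eq_0_if_orthogonal by blast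
    with w(1) obtain t k where t: "t \<ge> 0" "w + t *\<^sub>R v' \<in> slab l u" "a k \<bullet> v' \<noteq> 0"
       "a k \<bullet> (w + t *\<^sub>R v') \<in> {l k, u k}"
      using slab_exit[of w l u k0 v'] unfolding good_def by metis
    have "good (w + t *\<^sub>R v')"
      using t(1,2) w(1) mult_nonneg_nonpos[OF t(1) \<open>f \<bullet> v' \<le> 0\<close>] by (auto simp: good_def inner_add_right)
    moreover have "T w \<subseteq> T (w + t *\<^sub>R v')" using v' by (auto simp: T_def ker_def inner_add_right)
    moreover have "k \<in> T (w + t *\<^sub>R v')" "k \<notin> T w" using t(3,4) v' by (auto simp: T_def ker_def)
    ultimately have "T w \<subset> T (w + t *\<^sub>R v')" by blast
    then have "card (T w) < card (T (w + t *\<^sub>R v'))" by (simp add: psubset_card_mono)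
    with w(2)[OF \<open>good (w + t *\<^sub>R v')\<close>] show False by simp
  qed
  then have "ker (T w) = {0}" using subspace_0[OF subspace_ker] by blast
  with w(1) show thesis using that[of w] by (simp add: good_def T_def)
qed

end

lemma (in row_system) ker_add: "x \<in> ker J \<Longrightarrow> y \<in> ker J \<Longrightarrow> x + y \<in> ker J"
  and ker_diff: "x \<in> ker J \<Longrightarrow> y \<in> ker J \<Longrightarrow> x - y \<in> ker J"
  and ker_scaleR: "x \<in> ker J \<Longrightarrow> c *\<^sub>R x \<in> ker J"
  using subspace_ker by (auto intro: subspace_add subspace_diff subspace_scale)

lemma (in row_system) slab_segment:
  assumes w: "w \<in> slab l u" "w' \<in> slab l u" and s: "0 \<le> s" "s \<le> 1"
  shows "w + s *\<^sub>R (w' - w) \<in> slab l u"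
  unfolding slab_def
proof (intro CollectI allI conjI)
  fix i
  have eq: "a i \<bullet> (w + s *\<^sub>R (w' - w)) = (1 - s) * (a i \<bullet> w) + s * (a i \<bullet> w')"
    by (simp add: inner_add_right inner_diff_right algebra_simps)
  have "(1 - s) * l i + s * l i \<le> (1 - s) * (a i \<bullet> w) + s * (a i \<bullet> w')"
    using w s by (intro add_mono mult_left_mono) (auto simp: slab_def)
  then show "l i \<le> a i \<bullet> (w + s *\<^sub>R (w' - w))" by (simp add: eq algebra_simps)
  have "(1 - s) * (a i \<bullet> w) + s * (a i \<bullet> w') \<le> (1 - s) * u i + s * u i"
    using w s by (intro add_mono mult_left_mono) (auto simp: slab_def)
  then show "a i \<bullet> (w + s *\<^sub>R (w' - w)) \<le> u i" by (simp add: eq algebra_simps)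
qed

section \<open>Integer points in bimodular polytopes\<close>

locale bimodular = row_system a for a :: "'m::finite \<Rightarrow> real ^ 'n" +
  assumes int_vec_row: "int_vec (a i)"
    and abs_minor_le_2: "inj r \<Longrightarrow> \<bar>det (\<chi> k. a (r k))\<bar> \<le> 2"
begin

text \<open>A row that vanishes on \<open>ker J\<close> counts as even too. Otherwise this is the
  case of content 2, as \<open>half_integral_dual_vector\<close> shows.\<close>

definition even_on_ker :: "'m \<Rightarrow> 'm set \<Rightarrow> bool" where
  "even_on_ker i J \<longleftrightarrow> (\<forall>z\<in>ker J. int_vec z \<longrightarrow> a i \<bullet> z / 2 \<in> \<int>)"

lemma int_vec_minor_mult_iff:
  "int_vec ((\<chi> k. a (r k)) *v y) \<longleftrightarrow> (\<forall>k. a (r k) \<bullet> y \<in> \<int>)"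
  by (simp add: int_vec_def matrix_vector_mul_component)

text \<open>\<open>e\<close> is the dual vector to row \<open>i\<close> in the basis from
  \<open>basis_rows\<close>: it vanishes on the other basis rows, among them those from
  \<open>J\<close>, and hence on all rows in \<open>J\<close>.\<close>

lemma basis_rows_dual:
  assumes v: "v \<in> ker J" "a i \<bullet> v \<noteq> 0" and K: "ker K = {0}" "insert i J \<subseteq> K"
  obtains r :: "'n \<Rightarrow> 'm" and e where "inj r" "range r \<subseteq> K" "det (\<chi> k. a (r k)) \<noteq> 0"
    "e \<in> ker J" "a i \<bullet> e = 1" "\<And>k. a (r k) \<bullet> e \<in> \<int>"
proof -
  obtain r :: "'n \<Rightarrow> 'm" where r: "inj r" "range r \<subseteq> K" "i \<in> range r" "det (\<chi> k. a (r k)) \<noteq> 0"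
    "\<And>y. (\<And>k. r k \<in> J \<Longrightarrow> a (r k) \<bullet> y = 0) \<Longrightarrow> y \<in> ker J"
    using basis_rows[OF assms] by metis
  from r(3) obtain k0 where k0: "i = r k0" by blast
  let ?M = "\<chi> k. a (r k)"
  have "invertible ?M" using r(4) by (simp add: invertible_det_nz)
  then obtain N where "?M ** N = mat 1" by (auto simp: invertible_def)
  then have "?M *v (N *v axis k0 1) = axis k0 1"
    by (simp add: matrix_vector_mul_assoc)
  then obtain e where "?M *v e = axis k0 1" by blast
  then have e: "a (r k) \<bullet> e = axis k0 1 $ k" for k
    by (metis matrix_vector_mul_component vec_lambda_beta)
  have "i \<notin> J" using v by (auto simp: ker_def)
  then have "e \<in> ker J" by (intro r(5)) (auto simp: e k0 axis_def)
  then show thesis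
    by (rule that[OF r(1,2,4)]) (simp_all add: k0 e axis_def)
qed

text \<open>The rows in \<open>K\<close> contain an invertible minor, of determinant at most 2 in
  absolute value, under which the image of \<open>d\<close> is integral. So vertices of slabs with
  integer bounds are half-integral.\<close>

lemma half_integral_if_tight:
  assumes K: "ker K = {0}" and d: "\<And>k. k \<in> K \<Longrightarrow> a k \<bullet> d \<in> \<int>"
  shows "int_vec (2 *\<^sub>R d)"
proof -
  \<comment> \<open>The all-ones vector is just some nonzero vector; it yields a row in
    \<open>K\<close> from which \<open>basis_rows_dual\<close> can start, with \<open>J\<close>
    empty.\<close>
  have "(1 :: real ^ 'n) \<notin> ker K" using K by (simp add: vec_eq_iff)
  then obtain i where i: "i \<in> K" "a i \<bullet> 1 \<noteq> 0" by (auto simp: ker_def)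
  then have "(1 :: real ^ 'n) \<in> ker {}" "insert i {} \<subseteq> K" by (auto simp: ker_def)
  from basis_rows_dual[OF this(1) i(2) K this(2)]
  obtain r :: "'n \<Rightarrow> 'm" where r: "inj r" "range r \<subseteq> K" "det (\<chi> k. a (r k)) \<noteq> 0" by metis
  then have M: "int_vec ((\<chi> k. a (r k)) *v d)" using d by (auto simp: int_vec_minor_mult_iff)
  show ?thesis
  proof (cases "int_vec d")
    case True
    then show ?thesis by (intro int_vec_scaleR) auto
  next
    case False
    show ?thesis
      by (rule half_integral_if_det_le_2(2)[OF _ M r(3) abs_minor_le_2[OF r(1)] False])
        (simp add: int_vec_row)
  qed
qed

text \<open>The dual vector \<open>e\<close> is not integral, since the even row takes the value 1
  on it. If \<open>d\<close> were not integral either, \<open>d + e\<close> would be, the index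
  being at most 2; but row \<open>i\<close> is odd on \<open>d + e\<close>.\<close>

lemma int_vec_if_tight:
  assumes v: "v \<in> ker J" "a i \<bullet> v \<noteq> 0" and K: "ker K = {0}" "insert i J \<subseteq> K"
    and even: "even_on_ker i J"
    and d: "d \<in> ker J" "\<And>k. k \<in> K \<Longrightarrow> a k \<bullet> d \<in> \<int>" "a i \<bullet> d / 2 \<in> \<int>"
  shows "int_vec d"
proof (rule ccontr)
  assume nd: "\<not> int_vec d"
  obtain r :: "'n \<Rightarrow> 'm" and e where r: "inj r" "range r \<subseteq> K" "det (\<chi> k. a (r k)) \<noteq> 0"
    and e: "e \<in> ker J" "a i \<bullet> e = 1" "\<And>k. a (r k) \<bullet> e \<in> \<int>"
    using basis_rows_dual[OF v K] by metis
  have ne: "\<not> int_vec e"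
  proof
    assume "int_vec e"
    with even e(1) have "a i \<bullet> e / 2 \<in> \<int>" by (simp add: even_on_ker_def)
    then show False by (simp add: e(2))
  qed
  have "int_vec (d + e)"
  proof (rule int_vec_add_if_det_le_2[OF _ _ _ r(3) abs_minor_le_2[OF r(1)] nd ne])
    show "int_vec ((\<chi> k. a (r k)) *v d)" "int_vec ((\<chi> k. a (r k)) *v e)"
      using r(2) d(2) e(3) by (auto simp: int_vec_minor_mult_iff)
  qed (simp add: int_vec_row)
  moreover have "d + e \<in> ker J" using d(1) e(1) by (rule ker_add)
  ultimately have "a i \<bullet> (d + e) / 2 \<in> \<int>" using even by (simp add: even_on_ker_def)
  then have "a i \<bullet> d / 2 + 1 / 2 \<in> \<int>" by (simp add: inner_add_right e(2) add_divide_distrib)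
  from Ints_diff[OF this d(3)] show False by simp
qed

lemma ker_UNIV: "ker UNIV = {0}"
  using eq_0_if_orthogonal by (auto simp: ker_def)

text \<open>Twice \<open>e\<close> is a lattice point of \<open>ker J\<close> with value 2, so a row
  not vanishing on \<open>ker J\<close> has content 1 or 2 there.\<close>

lemma half_integral_dual_vector:
  assumes v: "v \<in> ker J" "a i \<bullet> v \<noteq> 0"
  obtains e where "e \<in> ker J" "int_vec (2 *\<^sub>R e)" "a i \<bullet> e = 1"
proof -
  obtain r :: "'n \<Rightarrow> 'm" and e where r: "inj r" "det (\<chi> k. a (r k)) \<noteq> 0"
    and e: "e \<in> ker J" "a i \<bullet> e = 1" "\<And>k. a (r k) \<bullet> e \<in> \<int>"
    using basis_rows_dual[OF v ker_UNIV] by (metis subset_UNIV)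
  have "int_vec (2 *\<^sub>R e)"
  proof (cases "int_vec e")
    case False
    show ?thesis
    proof (rule half_integral_if_det_le_2(2)[OF _ _ r(2) abs_minor_le_2[OF r(1)] False])
      show "int_vec ((\<chi> k. a (r k)) *v e)" using e(3) by (simp add: int_vec_minor_mult_iff)
    qed (simp add: int_vec_row)
  qed (auto intro: int_vec_scaleR)
  with e(1,2) show thesis by (intro that)
qed

text \<open>Some lattice point \<open>v\<close> has an odd value, and twice the half-integral dual
  vector \<open>e\<close> has value 2; subtracting multiples of the latter changes the odd value to
  1.\<close>

lemma unit_value_if_not_even:
  assumes "\<not> even_on_ker i J"
  obtains z where "z \<in> ker J" "int_vec z" "a i \<bullet> z = 1"
proof -
  obtain v where v: "v \<in> ker J" "int_vec v" "a i \<bullet> v / 2 \<notin> \<int>"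
    using assms by (auto simp: even_on_ker_def)
  then have "a i \<bullet> v \<noteq> 0" by auto
  with v(1) obtain e where e: "e \<in> ker J" "int_vec (2 *\<^sub>R e)" "a i \<bullet> e = 1"
    by (rule half_integral_dual_vector)
  obtain q :: int where q: "a i \<bullet> v = of_int q"
    using int_vec_inner[OF int_vec_row v(2)] by (auto elim: Ints_cases)
  have "odd q"
  proof
    assume "even q"
    then obtain m where "q = 2 * m" by (elim evenE)
    with v(3) show False by (simp add: q)
  qed
  then obtain m where m: "q = 2 * m + 1" by (elim oddE)
  show thesis
  proof (rule that)
    show "v - of_int m *\<^sub>R (2 *\<^sub>R e) \<in> ker J"
      using v(1) e(1) by (intro ker_diff ker_scaleR)
    show "int_vec (v - of_int m *\<^sub>R (2 *\<^sub>R e))"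
      by (rule int_vec_diff[OF v(2) int_vec_scaleR[OF Ints_of_int e(2)]])
    show "a i \<bullet> (v - of_int m *\<^sub>R (2 *\<^sub>R e)) = 1"
      by (simp add: inner_diff_right q m e(3))
  qed
qed

text \<open>Vertices are half-integral relative to \<open>p\<close>, so the even row
  \<open>i\<close> has integer values \<open>a i \<bullet> (w - p)\<close> on them, and strictness
  gives two vertices with different values. In this range lies an even value, and the slice there
  has integral vertices by \<open>int_vec_if_tight\<close>.\<close>

lemma int_point_if_even:
  assumes l: "\<And>i. l i \<in> \<int>" and u: "\<And>i. u i \<in> \<int>" and p: "int_vec p"
    and y: "y \<in> slab l u" "y - p \<in> ker J"
    and strict: "\<And>i v. v \<in> ker J \<Longrightarrow> a i \<bullet> v \<noteq> 0 \<Longrightarrow> l i < a i \<bullet> y \<and> a i \<bullet> y < u i"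
    and v: "v \<in> ker J" "a i \<bullet> v \<noteq> 0" and even: "even_on_ker i J"
  shows "\<exists>q. int_vec q \<and> q \<in> slab l u \<and> q - p \<in> ker J"
proof -
  \<comment> \<open>Equal lower and upper bounds on the rows in \<open>J\<close> turn the part of
    the slab in \<open>p + ker J\<close> into a slab itself, so that \<open>slab_vertex\<close>
    applies to it.\<close>
  define l' where "l' = (\<lambda>j. if j \<in> J then a j \<bullet> p else l j)"
  define u' where "u' = (\<lambda>j. if j \<in> J then a j \<bullet> p else u j)"
  have ap: "a j \<bullet> p \<in> \<int>" for j using int_vec_row p by (rule int_vec_inner)
  have bounds: "l' j \<in> \<int>" "u' j \<in> \<int>" for j using l u ap by (auto simp: l'_def u'_def)
  have yJ: "a j \<bullet> y = a j \<bullet> p" if "j \<in> J" for j using y(2) that by (auto simp: ker_def inner_diff_right)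
  have slab': "w \<in> slab l' u' \<longleftrightarrow> w \<in> slab l u \<and> w - p \<in> ker J" for w
  proof
    assume w: "w \<in> slab l' u'"
    then have "a j \<bullet> w = a j \<bullet> p" if "j \<in> J" for j
      using that by (force simp: slab_def l'_def u'_def intro: antisym dest: spec[of _ j])
    moreover from this have "l j \<le> a j \<bullet> w \<and> a j \<bullet> w \<le> u j" for j
      using w y(1) yJ[of j] by (cases "j \<in> J") (force simp: slab_def l'_def u'_def dest: spec[of _ j])+
    ultimately show "w \<in> slab l u \<and> w - p \<in> ker J"
      by (simp add: slab_def ker_def inner_diff_right)
  qed (auto simp: slab_def ker_def inner_diff_right l'_def u'_def)
  have tight_int: "a k \<bullet> (w - p) \<in> \<int>" if "a k \<bullet> w \<in> {l' k, u' k}" for k w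
    using that bounds[of k] ap[of k] by (auto simp: inner_diff_right)
  define e where "e = (1 / (a i \<bullet> v)) *\<^sub>R v"
  have e: "c *\<^sub>R e \<in> ker J" "a i \<bullet> (c *\<^sub>R e) = c" for c
    using v by (auto simp: e_def intro!: ker_scaleR)
  \<comment> \<open>Used with \<open>c\<close> equal to 1 and to -1. Strictness leaves room to move
    from \<open>y\<close> in the direction \<open>(- c) *\<^sub>R e\<close>, which strictly lowers
    \<open>c * (a i \<bullet> y)\<close>; a vertex at least as low then exists.\<close>
  have vertex: "\<exists>w. w \<in> slab l' u' \<and> a i \<bullet> (w - p) \<in> \<int> \<and> c * (a i \<bullet> w) < c * (a i \<bullet> y)"
    if c: "c \<noteq> 0" for c
  proof -
    have "a i \<bullet> ((- c) *\<^sub>R e) \<noteq> 0" using c e(2)[of "- c"] by linarith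
    from slab_exit[OF y(1) this] strict[OF e(1)[of "- c"]] obtain t where
      t: "t > 0" "y + t *\<^sub>R ((- c) *\<^sub>R e) \<in> slab l u" by metis
    have "y + t *\<^sub>R ((- c) *\<^sub>R e) - p = (y - p) + t *\<^sub>R ((- c) *\<^sub>R e)" by simp
    then have "y + t *\<^sub>R ((- c) *\<^sub>R e) - p \<in> ker J" using y(2) e(1) by (metis ker_add ker_scaleR)
    with t(2) have "y + t *\<^sub>R ((- c) *\<^sub>R e) \<in> slab l' u'" by (simp add: slab')
    from slab_vertex[OF this, of "c *\<^sub>R a i"] obtain w where w: "w \<in> slab l' u'"
      "c *\<^sub>R a i \<bullet> w \<le> c *\<^sub>R a i \<bullet> (y + t *\<^sub>R ((- c) *\<^sub>R e))"
      "ker {k. a k \<bullet> w \<in> {l' k, u' k}} = {0}" by blast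
    have "int_vec (2 *\<^sub>R (w - p))"
      by (rule half_integral_if_tight[OF w(3)]) (use tight_int in blast)
    moreover have "w - p \<in> ker J" using w(1) slab' by blast
    ultimately have "a i \<bullet> (2 *\<^sub>R (w - p)) / 2 \<in> \<int>"
      using even ker_scaleR by (auto simp: even_on_ker_def)
    then have "a i \<bullet> (w - p) \<in> \<int>" by simp
    moreover have "c *\<^sub>R a i \<bullet> (y + t *\<^sub>R ((- c) *\<^sub>R e)) = c * (a i \<bullet> y) - t * (c * c)"
      using e(2)[of 1] by (simp add: inner_add_right algebra_simps)
    then have "c * (a i \<bullet> w) < c * (a i \<bullet> y)"
      using w(2) t(1) c by (smt (verit) inner_scaleR_left mult_pos_pos not_real_square_gt_zero)
    ultimately show ?thesis using w(1) by blast
  qed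
  obtain w1 where w1: "w1 \<in> slab l' u'" "a i \<bullet> (w1 - p) \<in> \<int>" "a i \<bullet> w1 < a i \<bullet> y"
    using vertex[of 1] by auto
  obtain w2 where w2: "w2 \<in> slab l' u'" "a i \<bullet> (w2 - p) \<in> \<int>" "a i \<bullet> y < a i \<bullet> w2"
    using vertex[of "-1"] by auto
  obtain \<alpha> \<beta> :: int where \<alpha>: "a i \<bullet> (w1 - p) = of_int \<alpha>" and \<beta>: "a i \<bullet> (w2 - p) = of_int \<beta>"
    using w1(2) w2(2) by (auto elim!: Ints_cases)
  have "\<alpha> < \<beta>" using w1(3) w2(3) \<alpha> \<beta> by (simp add: inner_diff_right)
  \<comment> \<open>Of two consecutive integers one is even; evenness of \<open>c\<close> is what
    \<open>int_vec_if_tight\<close> needs on the slice.\<close>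
  obtain c :: int where c: "\<alpha> \<le> c" "c \<le> \<beta>" "even c"
  proof (cases "even \<alpha>")
    case True
    then show thesis using that[of \<alpha>] \<open>\<alpha> < \<beta>\<close> by simp
  next
    case False
    then show thesis using that[of "\<alpha> + 1"] \<open>\<alpha> < \<beta>\<close> by simp
  qed
  define s where "s = (real_of_int c - \<alpha>) / (\<beta> - \<alpha>)"
  define x where "x = w1 + s *\<^sub>R (w2 - w1)"
  have s: "0 \<le> s" "s \<le> 1" "s * (\<beta> - \<alpha>) = c - \<alpha>"
    using c(1,2) \<open>\<alpha> < \<beta>\<close> by (auto simp: s_def)
  have x: "x \<in> slab l' u'" unfolding x_def by (rule slab_segment[OF w1(1) w2(1) s(1,2)])
  have xi: "a i \<bullet> x = a i \<bullet> p + c"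
  proof -
    have "a i \<bullet> (w2 - w1) = \<beta> - \<alpha>" using \<alpha> \<beta> by (simp add: inner_diff_right)
    then have "a i \<bullet> x = a i \<bullet> w1 + (c - \<alpha>)" using s(3) by (simp add: x_def inner_add_right)
    then show ?thesis using \<alpha> by (simp add: inner_diff_right)
  qed
  \<comment> \<open>Row \<open>i\<close> is pinned to the even offset \<open>c\<close>, so that the
    tight rows of a vertex of this slice contain \<open>insert i J\<close>.\<close>
  define l'' where "l'' = l'(i := a i \<bullet> p + c)"
  define u'' where "u'' = u'(i := a i \<bullet> p + c)"
  have "x \<in> slab l'' u''" using x xi by (simp add: slab_def l''_def u''_def)
  from slab_vertex[OF this, of 0] obtain q where q: "q \<in> slab l'' u''"
    "ker {k. a k \<bullet> q \<in> {l'' k, u'' k}} = {0}" by blast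
  have qi: "a i \<bullet> q = a i \<bullet> p + c" using q(1) by (force simp: slab_def l''_def u''_def dest: spec[of _ i])
  have "q \<in> slab l' u'"
    unfolding slab_def
  proof (intro CollectI allI)
    fix k
    show "l' k \<le> a k \<bullet> q \<and> a k \<bullet> q \<le> u' k"
      using q(1) x qi xi by (cases "k = i") (force simp: slab_def l''_def u''_def dest: spec[of _ k])+
  qed
  then have q': "q \<in> slab l u" "q - p \<in> ker J" by (auto simp: slab')
  have "i \<notin> J" using v by (auto simp: ker_def)
  have "int_vec (q - p)"
  proof (rule int_vec_if_tight[OF v q(2) _ even q'(2)])
    show "insert i J \<subseteq> {k. a k \<bullet> q \<in> {l'' k, u'' k}}"
      using qi q'(2) \<open>i \<notin> J\<close> by (auto simp: l''_def u''_def l'_def u'_def ker_def inner_diff_right)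
    show "a k \<bullet> (q - p) \<in> \<int>" if "k \<in> {k. a k \<bullet> q \<in> {l'' k, u'' k}}" for k
      using that tight_int[of k q] qi by (cases "k = i") (auto simp: l''_def u''_def inner_diff_right)
    show "a i \<bullet> (q - p) / 2 \<in> \<int>" using qi c(3) by (auto simp: inner_diff_right elim!: evenE)
  qed
  from int_vec_add[OF this p] have "int_vec q" by simp
  with q' show ?thesis by blast
qed

end

section \<open>Passing to a facet\<close>

lemma (in row_system) ker_insert_subset: "ker (insert i J) \<subseteq> ker J"
  by (auto simp: ker_def)

text \<open>The point leaves \<open>y\<close> in a generic direction of \<open>ker J\<close>. Two
  rows then reach bounds at the same time only if they are proportional on \<open>ker J\<close>, so
  every further tight row vanishes on \<open>ker (insert k J)\<close>.\<close>

lemma (in row_system) generic_facet_point: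
  assumes y: "y \<in> slab l u"
    and strict: "\<And>i v. v \<in> ker J \<Longrightarrow> a i \<bullet> v \<noteq> 0 \<Longrightarrow> l i < a i \<bullet> y \<and> a i \<bullet> y < u i"
    and ne: "ker J \<noteq> {0}"
  obtains z k v where "z - y \<in> ker J" "z \<in> slab l u" "v \<in> ker J" "a k \<bullet> v \<noteq> 0" "a k \<bullet> z \<in> {l k, u k}"
    "\<And>i v. v \<in> ker (insert k J) \<Longrightarrow> a i \<bullet> v \<noteq> 0 \<Longrightarrow> l i < a i \<bullet> z \<and> a i \<bullet> z < u i"
proof -
  define bd where "bd s k = (if s then l k else u k)" for s k
  \<comment> \<open>Vanishes at \<open>v\<close> whenever rows \<open>k\<close> and
    \<open>k'\<close> meet the bounds selected by \<open>s\<close> and \<open>s'\<close> at the same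
    time on the ray from \<open>y\<close> along \<open>v\<close>.\<close>
  define \<phi> where "\<phi> = (\<lambda>(k, k', s, s'). (bd s k - a k \<bullet> y) *\<^sub>R a k' - (bd s' k' - a k' \<bullet> y) *\<^sub>R a k)"
  \<comment> \<open>The rows themselves are included so that \<open>v\<close> moves at least one of
    them and the ray leaves the slab.\<close>
  define \<Phi> where "\<Phi> = {f \<in> range \<phi> \<union> range a. \<exists>v\<in>ker J. f \<bullet> v \<noteq> 0}"
  have "finite \<Phi>" by (auto simp: \<Phi>_def)
  obtain v where v: "v \<in> ker J" "\<And>f. f \<in> \<Phi> \<Longrightarrow> f \<bullet> v \<noteq> 0"
  proof (rule generic_element[of "ker J" \<Phi>])
    show "ker J \<noteq> {}" using subspace_0[OF subspace_ker] by blast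
  qed (use \<open>finite \<Phi>\<close> ker_add in \<open>auto simp: \<Phi>_def\<close>)
  obtain k0 where "a k0 \<bullet> v \<noteq> 0"
  proof -
    obtain x where "x \<in> ker J" "x \<noteq> 0" using ne subspace_0[OF subspace_ker] by blast
    then obtain k where "a k \<bullet> x \<noteq> 0" using eq_0_if_orthogonal by blast
    with \<open>x \<in> ker J\<close> have "a k \<in> \<Phi>" by (auto simp: \<Phi>_def)
    from v(2)[OF this] show thesis by (rule that)
  qed
  from slab_exit[OF y this] obtain t k where t: "y + t *\<^sub>R v \<in> slab l u" "a k \<bullet> v \<noteq> 0"
    "a k \<bullet> (y + t *\<^sub>R v) \<in> {l k, u k}" by metis
  let ?z = "y + t *\<^sub>R v"
  show thesis
  proof (rule that[OF _ t(1) v(1) t(2,3)])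
    show "?z - y \<in> ker J" using v(1) by (simp add: ker_scaleR)
    fix i w assume w: "w \<in> ker (insert k J)" "a i \<bullet> w \<noteq> 0"
    obtain s where s: "a k \<bullet> ?z = bd s k" using t(3) unfolding bd_def by (metis insertE singletonD)
    have nk: "bd s k \<noteq> a k \<bullet> y" for s using strict[OF v(1) t(2)] by (auto simp: bd_def)
    have False if tight: "a i \<bullet> ?z \<in> {l i, u i}"
    proof -
      obtain s' where s': "a i \<bullet> ?z = bd s' i" using tight unfolding bd_def by (metis insertE singletonD)
      let ?f = "\<phi> (k, i, s, s')"
      have "bd s k - a k \<bullet> y = t * (a k \<bullet> v)" "bd s' i - a i \<bullet> y = t * (a i \<bullet> v)"
        by (simp_all flip: s s' add: inner_add_right)
      then have "?f \<bullet> v = 0" by (simp add: \<phi>_def inner_diff_left)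
      then have "?f \<notin> \<Phi>" using v(2) by blast
      moreover have "?f \<bullet> w = (bd s k - a k \<bullet> y) * (a i \<bullet> w)"
        using w(1) by (simp add: \<phi>_def inner_diff_left ker_def)
      then have "?f \<bullet> w \<noteq> 0" using nk[of s] w(2) by simp
      ultimately show False using w(1) ker_insert_subset by (auto simp: \<Phi>_def)
    qed
    moreover have "l i \<le> a i \<bullet> ?z" "a i \<bullet> ?z \<le> u i" using t(1) by (simp_all add: slab_def)
    ultimately show "l i < a i \<bullet> ?z \<and> a i \<bullet> ?z < u i" by force
  qed
qed

context bimodular
begin

text \<open>The theorem of Veselov and Chirkov, relative to the affine space \<open>p + ker J\<close>. If some row is
  even on the lattice of \<open>ker J\<close>, suitable slices by it have integral vertices; otherwise every
  facet again spans an affine space containing integer points.\<close>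
lemma int_point_in_slab:
  assumes l: "\<And>i. l i \<in> \<int>" and u: "\<And>i. u i \<in> \<int>" and p: "int_vec p"
    and y: "y \<in> slab l u" "y - p \<in> ker J"
    and strict: "\<And>i v. v \<in> ker J \<Longrightarrow> a i \<bullet> v \<noteq> 0 \<Longrightarrow> l i < a i \<bullet> y \<and> a i \<bullet> y < u i"
  shows "\<exists>q. int_vec q \<and> q \<in> slab l u \<and> q - p \<in> ker J"
  using p y strict
\<comment> \<open>Rows not identically zero on \<open>ker J\<close> are counted; passing to the
  facet of row \<open>k\<close> removes \<open>k\<close> from them.\<close>
proof (induction "card {i. \<exists>v\<in>ker J. a i \<bullet> v \<noteq> 0}" arbitrary: J p y rule: less_induct)
  case (less J p y)
  show ?case
  proof (cases "ker J = {0}")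
    case True
    then have "y = p" using less.prems(3) by simp
    with less.prems True show ?thesis by auto
  next
    case ne: False
    show ?thesis
    proof (cases "\<exists>i. \<exists>v\<in>ker J. a i \<bullet> v \<noteq> 0 \<and> even_on_ker i J")
      case True
      then obtain i v where "v \<in> ker J" "a i \<bullet> v \<noteq> 0" "even_on_ker i J" by blast
      show ?thesis
        by (rule int_point_if_even[OF l u less.prems(1-3) _ \<open>v \<in> ker J\<close> \<open>a i \<bullet> v \<noteq> 0\<close> \<open>even_on_ker i J\<close>])
          (use less.prems(4) in blast)+
    next
      case False
      obtain z k v where
        z: "z - y \<in> ker J" "z \<in> slab l u" and k: "v \<in> ker J" "a k \<bullet> v \<noteq> 0" "a k \<bullet> z \<in> {l k, u k}" and
        strict': "\<And>i v. v \<in> ker (insert k J) \<Longrightarrow> a i \<bullet> v \<noteq> 0 \<Longrightarrow> l i < a i \<bullet> z \<and> a i \<bullet> z < u i"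
        by (rule generic_facet_point[OF less.prems(2) _ ne]) (use less.prems(4) in blast)+
      from False k have "\<not> even_on_ker k J" by blast
      then obtain e where e: "e \<in> ker J" "int_vec e" "a k \<bullet> e = 1" by (rule unit_value_if_not_even)
      \<comment> \<open>Because row \<open>k\<close> takes the value 1 on the lattice point
        \<open>e\<close>, an integer multiple of \<open>e\<close> moves \<open>p\<close> into the
        hyperplane of the facet.\<close>
      define p' where "p' = p + (a k \<bullet> z - a k \<bullet> p) *\<^sub>R e"
      have "a k \<bullet> z - a k \<bullet> p \<in> \<int>"
        using k(3) l u int_vec_inner[OF int_vec_row less.prems(1)] by (auto intro: Ints_diff)
      then have "int_vec p'" unfolding p'_def by (intro int_vec_add int_vec_scaleR less.prems(1) e(2))
      have p'p: "p' - p \<in> ker J" using e(1) by (simp add: p'_def ker_scaleR)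
      have "z - p' = (z - y) + (y - p) - (p' - p)" by simp
      then have "z - p' \<in> ker J" using z(1) less.prems(3) p'p by (metis ker_add ker_diff)
      then have zp': "z - p' \<in> ker (insert k J)"
        using e(3) by (simp add: ker_def p'_def inner_diff_right inner_add_right)
      have "{i. \<exists>v\<in>ker (insert k J). a i \<bullet> v \<noteq> 0} \<subset> {i. \<exists>v\<in>ker J. a i \<bullet> v \<noteq> 0}"
      proof
        show "{i. \<exists>v\<in>ker (insert k J). a i \<bullet> v \<noteq> 0} \<subseteq> {i. \<exists>v\<in>ker J. a i \<bullet> v \<noteq> 0}"
          using ker_insert_subset by blast
        have "k \<notin> {i. \<exists>v\<in>ker (insert k J). a i \<bullet> v \<noteq> 0}" by (auto simp: ker_def)
        with k(1,2) show "{i. \<exists>v\<in>ker (insert k J). a i \<bullet> v \<noteq> 0} \<noteq> {i. \<exists>v\<in>ker J. a i \<bullet> v \<noteq> 0}" by blast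
      qed
      then have "card {i. \<exists>v\<in>ker (insert k J). a i \<bullet> v \<noteq> 0} < card {i. \<exists>v\<in>ker J. a i \<bullet> v \<noteq> 0}"
        by (simp add: psubset_card_mono)
      from less.hyps[OF this \<open>int_vec p'\<close> z(2) zp'] strict' obtain q where
        q: "int_vec q" "q \<in> slab l u" "q - p' \<in> ker (insert k J)" by blast
      have "q - p = (q - p') + (p' - p)" by simp
      then have "q - p \<in> ker J" using q(3) p'p ker_insert_subset by (metis ker_add subsetD)
      with q show ?thesis by blast
    qed
  qed
qed

end

section \<open>Irreducible points and the Hilbert basis\<close>

context row_system
begin

definition points :: "(real ^ 'n) set" where
  "points = {x. int_vec x \<and> (\<forall>i. 0 \<le> a i \<bullet> x)}"

definition atoms :: "(real ^ 'n) set" where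
  "atoms = {g \<in> points. g \<noteq> 0 \<and> (\<forall>y\<in>points. \<forall>z\<in>points. g = y + z \<longrightarrow> y = 0 \<or> z = 0)}"

lemma points_add: "x \<in> points \<Longrightarrow> y \<in> points \<Longrightarrow> x + y \<in> points"
  by (auto simp: points_def inner_add_right int_vec_add)

lemma points_0: "0 \<in> points"
  by (simp add: points_def)

text \<open>Supplies the measure for \<open>atom_below\<close>: splitting a point into two nonzero
  points lowers the row sum.\<close>

lemma sum_rows_pos:
  assumes "x \<in> points" "x \<noteq> 0"
  shows "0 < (\<Sum>i\<in>UNIV. a i \<bullet> x)"
proof -
  obtain i where "a i \<bullet> x \<noteq> 0" using assms(2) eq_0_if_orthogonal by blast
  with assms(1) have "0 < a i \<bullet> x" by (auto simp: points_def order_less_le)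
  with assms(1) show ?thesis by (intro sum_pos2[of _ i]) (auto simp: points_def)
qed

end

section \<open>Irreducible points in a face and decompositions\<close>

context bimodular
begin

lemma inner_row_int: "int_vec x \<Longrightarrow> a i \<bullet> x \<in> \<int>"
  using int_vec_row by (rule int_vec_inner)

text \<open>As long as the point is reducible, it is replaced by a nonzero summand; the row sum is a
  positive integer, so this ends.\<close>

lemma atom_below:
  assumes "h \<in> points" "h \<noteq> 0"
  obtains g where "g \<in> atoms" "h - g \<in> points"
proof -
  define s where "s x = (\<Sum>i\<in>UNIV. a i \<bullet> x)" for x
  have s_int: "s x \<in> \<int>" if "x \<in> points" for x
    using that by (auto simp: s_def points_def intro!: Ints_sum inner_row_int)
  have "\<exists>g\<in>atoms. h - g \<in> points"
    using assms
  proof (induction "nat \<lfloor>s h\<rfloor>" arbitrary: h rule: less_induct)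
    case less
    show ?case
    proof (cases "h \<in> atoms")
      case True
      then show ?thesis using points_0 by force
    next
      case False
      with less.prems obtain y z where yz: "y \<in> points" "z \<in> points" "h = y + z" "y \<noteq> 0" "z \<noteq> 0"
        by (auto simp: atoms_def)
      have "s h = s y + s z" by (simp add: s_def yz(3) inner_add_right sum.distrib)
      moreover have "s y > 0" "s z > 0" using yz sum_rows_pos by (auto simp: s_def)
      ultimately have "nat \<lfloor>s y\<rfloor> < nat \<lfloor>s h\<rfloor>"
        using s_int[OF yz(1)] s_int[OF yz(2)] by (auto elim!: Ints_cases)
      from less.hyps[OF this yz(1,4)] obtain g where "g \<in> atoms" "y - g \<in> points" by blast
      moreover have "h - g = (y - g) + z" by (simp add: yz(3))
      ultimately show ?thesis using yz(2) points_add by metis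
    qed
  qed
  then show thesis using that by blast
qed

lemma atom_in_face:
  assumes x: "x \<in> points" "x \<noteq> 0" and J: "J = {i. a i \<bullet> x = 0}"
    and c: "c = (\<lambda>i. if even_on_ker i J then 2 else 1)"
  obtains g where "g \<in> atoms" "g \<in> ker J" "\<And>i. a i \<bullet> g \<in> {0, c i}"
proof -
  have cpos: "c i > 0" for i by (simp add: c)
  have xpos: "a i \<bullet> x > 0" if "i \<notin> J" for i
    using x(1) that by (auto simp: J points_def order_less_le)
  \<comment> \<open>The relative interior of the smallest face containing \<open>x\<close>.\<close>
  define S where "S = {y \<in> ker J. \<forall>i. i \<notin> J \<longrightarrow> a i \<bullet> y > 0}"
  have xS: "x \<in> S" using xpos by (auto simp: S_def J ker_def)
  have S_add: "y + z \<in> S" if "y \<in> S" "z \<in> S" for y z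
    using that by (auto simp: S_def inner_add_right ker_add intro: add_pos_pos)
  \<comment> \<open>\<open>\<phi> (i, j)\<close> vanishes at \<open>y\<close> exactly when the
    quotients \<open>a i \<bullet> y / c i\<close> and \<open>a j \<bullet> y / c j\<close> agree; a
    generic \<open>y\<close> thus has ties only between rows proportional on
    \<open>ker J\<close>.\<close>
  define \<phi> where "\<phi> = (\<lambda>(i, j). c j *\<^sub>R a i - c i *\<^sub>R a j)"
  define \<Phi> where "\<Phi> = {f \<in> range \<phi>. \<exists>v\<in>ker J. f \<bullet> v \<noteq> 0}"
  obtain y where y: "y \<in> S" "\<And>f. f \<in> \<Phi> \<Longrightarrow> f \<bullet> y \<noteq> 0"
  proof (rule generic_element[of S \<Phi>])
    show "S \<noteq> {}" using xS by blast
    show "finite \<Phi>" by (simp add: \<Phi>_def)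
    fix f assume "f \<in> \<Phi>"
    then obtain v where v: "v \<in> ker J" "f \<bullet> v \<noteq> 0" by (auto simp: \<Phi>_def)
    \<comment> \<open>If \<open>f\<close> vanishes at \<open>x\<close>, a large multiple of
      \<open>x\<close> plus \<open>v\<close> stays in \<open>S\<close>, and \<open>f\<close> has the
      nonzero value \<open>f \<bullet> v\<close> there.\<close>
    show "\<exists>s\<in>S. f \<bullet> s \<noteq> 0"
    proof (cases "f \<bullet> x = 0")
      case True
      have "eventually (\<lambda>n. real n * (a i \<bullet> x) + a i \<bullet> v > 0) sequentially" if "i \<in> - J" for i
      proof (rule eventually_mono[OF eventually_gt_at_top])
        fix n assume "nat \<lceil>- (a i \<bullet> v) / (a i \<bullet> x)\<rceil> < n"
        then have "- (a i \<bullet> v) / (a i \<bullet> x) < real n" by linarith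
        moreover have "a i \<bullet> x > 0" using xpos that by simp
        ultimately have "- (a i \<bullet> v) < real n * (a i \<bullet> x)" by (simp only: pos_divide_less_eq)
        then show "real n * (a i \<bullet> x) + a i \<bullet> v > 0" by simp
      qed
      then have "eventually (\<lambda>n. \<forall>i\<in>- J. real n * (a i \<bullet> x) + a i \<bullet> v > 0) sequentially"
        by (intro eventually_ball_finite) auto
      then obtain n where n: "\<forall>i\<in>- J. real n * (a i \<bullet> x) + a i \<bullet> v > 0"
        using eventually_happens'[OF sequentially_bot] by blast
      have "real n *\<^sub>R x + v \<in> S"
        using n xS v(1) by (auto simp: S_def inner_add_right intro: ker_add ker_scaleR)
      moreover have "f \<bullet> (real n *\<^sub>R x + v) \<noteq> 0" using True v(2) by (simp add: inner_add_right)
      ultimately show ?thesis by blast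
    qed (use xS in blast)
  qed (use S_add in auto)
  have yJ: "y \<in> ker J" and ypos: "a i \<bullet> y > 0" if "i \<notin> J" for i
    using y(1) that by (auto simp: S_def)
  have "- J \<noteq> {}" using x(2) eq_0_if_orthogonal[of x] by (auto simp: J)
  then have ne: "(\<lambda>i. a i \<bullet> y / c i) ` (- J) \<noteq> {}" by simp
  obtain i where i: "i \<notin> J" "Max ((\<lambda>i. a i \<bullet> y / c i) ` (- J)) = a i \<bullet> y / c i"
    using Max_in[OF _ ne] by auto
  have le: "a j \<bullet> y / c j \<le> a i \<bullet> y / c i" if "j \<notin> J" for j
    using that by (simp flip: i(2))
  define t where "t = c i / (a i \<bullet> y)"
  have t: "t > 0" "t * (a i \<bullet> y) = c i" using ypos[OF i(1)] cpos[of i] by (auto simp: t_def)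
  have yle: "a j \<bullet> (t *\<^sub>R y) \<le> c j" if "j \<notin> J" for j
  proof -
    have "(a j \<bullet> y) * c i \<le> (a i \<bullet> y) * c j"
      using le[OF that] cpos by (simp add: pos_divide_le_eq pos_le_divide_eq field_simps)
    then show ?thesis using ypos[OF i(1)] by (simp add: t_def pos_divide_le_eq field_simps)
  qed
  have yi: "a i \<bullet> (t *\<^sub>R y) = c i" using t(2) by simp
  \<comment> \<open>An integer base point in the hyperplane of row \<open>i\<close> through
    \<open>t *\<^sub>R y\<close>: twice a dual vector if the row is even, a point of value 1
    otherwise.\<close>
  obtain p where p: "int_vec p" "p \<in> ker J" "a i \<bullet> p = c i"
  proof (cases "even_on_ker i J")
    case True
    obtain e where "e \<in> ker J" "int_vec (2 *\<^sub>R e)" "a i \<bullet> e = 1"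
      using half_integral_dual_vector[OF yJ[OF i(1)], of i] ypos[OF i(1)] by auto
    then show thesis using that[of "2 *\<^sub>R e"] True by (simp add: c ker_scaleR)
  next
    case False
    then obtain z where "z \<in> ker J" "int_vec z" "a i \<bullet> z = 1" by (rule unit_value_if_not_even)
    then show thesis using that[of z] False by (simp add: c)
  qed
  define u where "u = (\<lambda>j. if j \<in> J then 0 else c j)"
  have "\<exists>q. int_vec q \<and> q \<in> slab (\<lambda>_. 0) u \<and> q - p \<in> ker (insert i J)"
  proof (rule int_point_in_slab[OF _ _ p(1)])
    show "u j \<in> \<int>" for j by (simp add: u_def c)
    have tyJ: "t *\<^sub>R y \<in> ker J" using yJ[OF i(1)] by (rule ker_scaleR)
    have ty0: "a j \<bullet> (t *\<^sub>R y) > 0" if "j \<notin> J" for j using ypos[OF that] t(1) by simp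
    show "t *\<^sub>R y \<in> slab (\<lambda>_. 0) u"
      unfolding slab_def
    proof (intro CollectI allI)
      fix j
      show "0 \<le> a j \<bullet> (t *\<^sub>R y) \<and> a j \<bullet> (t *\<^sub>R y) \<le> u j"
      proof (cases "j \<in> J")
        case True
        then have "a j \<bullet> (t *\<^sub>R y) = 0" using tyJ unfolding ker_def by blast
        with True show ?thesis by (simp only: u_def if_True order.refl simp_thms)
      next
        case False
        then show ?thesis using ty0[of j] yle[of j] by (simp add: u_def)
      qed
    qed
    have "t *\<^sub>R y - p \<in> ker J" using tyJ p(2) by (rule ker_diff)
    then show "t *\<^sub>R y - p \<in> ker (insert i J)"
      using yi p(3) by (simp add: ker_def inner_diff_right)
    fix j v assume v: "v \<in> ker (insert i J)" "a j \<bullet> v \<noteq> 0"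
    then have "j \<notin> J" by (auto simp: ker_def)
    \<comment> \<open>Row \<open>j\<close> would tie with row \<open>i\<close>; by genericity the
      two would be proportional on \<open>ker J\<close>, and row \<open>j\<close> would vanish at
      \<open>v\<close>.\<close>
    have "a j \<bullet> (t *\<^sub>R y) \<noteq> c j"
    proof
      assume eq: "a j \<bullet> (t *\<^sub>R y) = c j"
      have "t * (\<phi> (i, j) \<bullet> y) = c j * (a i \<bullet> (t *\<^sub>R y)) - c i * (a j \<bullet> (t *\<^sub>R y))"
        by (simp add: \<phi>_def inner_diff_left algebra_simps)
      also have "\<dots> = 0" unfolding eq yi by simp
      finally have "t * (\<phi> (i, j) \<bullet> y) = 0" .
      then have "\<phi> (i, j) \<notin> \<Phi>" using y(2) t(1) by auto
      then have "\<phi> (i, j) \<bullet> v = 0" using v(1) ker_insert_subset by (auto simp: \<Phi>_def)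
      then show False using v cpos[of i] by (simp add: \<phi>_def inner_diff_left ker_def)
    qed
    then show "0 < a j \<bullet> (t *\<^sub>R y) \<and> a j \<bullet> (t *\<^sub>R y) < u j"
      using yle[OF \<open>j \<notin> J\<close>] ty0[OF \<open>j \<notin> J\<close>] \<open>j \<notin> J\<close> by (simp add: u_def)
  qed simp
  then obtain q where q: "int_vec q" "q \<in> slab (\<lambda>_. 0) u" "q - p \<in> ker (insert i J)" by blast
  have "q \<in> points" using q by (auto simp: points_def slab_def)
  moreover have "q \<noteq> 0" using q(3) p(3) cpos[of i] by (auto simp: ker_def)
  ultimately obtain g where g: "g \<in> atoms" "q - g \<in> points" by (rule atom_below)
  have gp: "int_vec g" "0 \<le> a j \<bullet> g" "a j \<bullet> g \<le> u j" for j
  proof -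
    show "int_vec g" "0 \<le> a j \<bullet> g" using g(1) by (auto simp: atoms_def points_def)
    have "a j \<bullet> g \<le> a j \<bullet> q" using g(2) by (auto simp: points_def inner_diff_right)
    also have "\<dots> \<le> u j" using q(2) by (simp add: slab_def)
    finally show "a j \<bullet> g \<le> u j" .
  qed
  have gJ: "g \<in> ker J"
    using gp(2,3) by (force simp: ker_def u_def intro: antisym dest: spec split: if_splits)
  \<comment> \<open>Row values at integer points of \<open>ker J\<close> are multiples of
    \<open>c j\<close>, and between 0 and \<open>c j\<close> only the two ends are left.\<close>
  have "a j \<bullet> g \<in> {0, c j}" for j
  proof (cases "even_on_ker j J")
    case True
    then have "a j \<bullet> g / 2 \<in> \<int>" using gJ gp(1) by (simp add: even_on_ker_def)
    then obtain m :: int where m: "a j \<bullet> g = 2 * of_int m" by (auto elim!: Ints_cases)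
    have "a j \<bullet> g \<le> 2" using gp(3)[of j] True by (auto simp: u_def c split: if_splits)
    then have "m = 0 \<or> m = 1" using gp(2)[of j] unfolding m by linarith
    then show ?thesis using True by (auto simp: m c)
  next
    case False
    obtain m :: int where m: "a j \<bullet> g = of_int m" using inner_row_int[OF gp(1)] by (auto elim!: Ints_cases)
    have "a j \<bullet> g \<le> 1" using gp(3)[of j] False by (auto simp: u_def c split: if_splits)
    then have "m = 0 \<or> m = 1" using gp(2)[of j] unfolding m by linarith
    then show ?thesis using False by (auto simp: m c)
  qed
  with g(1) gJ show thesis by (rule that)
qed

text \<open>The bound makes finiteness easy to see; \<open>bounded_atoms_eq\<close> shows later that
  every irreducible point satisfies it.\<close>

definition bounded_atoms :: "(real ^ 'n) set" where
  "bounded_atoms = {g \<in> atoms. \<forall>i. a i \<bullet> g \<le> 2}"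

text \<open>Induction on the dimension of the space cut out by the rows vanishing at
  \<open>x\<close>: each step removes a multiple of one irreducible point and leaves a point on a
  smaller face.\<close>

lemma decomposition:
  assumes "x \<in> points"
  shows "\<exists>S c. S \<subseteq> bounded_atoms \<and> finite S \<and> card S \<le> dim (ker {i. a i \<bullet> x = 0}) \<and>
    x = (\<Sum>g\<in>S. real (c g) *\<^sub>R g)"
  using assms
proof (induction "dim (ker {i. a i \<bullet> x = 0})" arbitrary: x rule: less_induct)
  case (less x)
  define J where "J = {i. a i \<bullet> x = 0}"
  show ?case
  proof (cases "x = 0")
    case True
    then show ?thesis by (intro exI[of _ "{}"]) simp
  next
    case False
    define c where "c = (\<lambda>i. if even_on_ker i J then 2 else 1 :: real)"
    obtain g where g: "g \<in> atoms" "g \<in> ker J" "\<And>i. a i \<bullet> g \<in> {0, c i}"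
      using atom_in_face[OF less.prems False J_def c_def] by metis
    have g': "g \<in> points" "g \<noteq> 0" using g(1) by (auto simp: atoms_def)
    have cpos: "c i > 0" "c i \<le> 2" for i by (auto simp: c_def)
    have xJ: "x \<in> ker J" by (simp add: ker_def J_def)
    have x: "int_vec x" "a i \<bullet> x \<ge> 0" for i using less.prems by (auto simp: points_def)
    \<comment> \<open>On \<open>ker J\<close> the values of row \<open>i\<close> at integer points
      are multiples of \<open>c i\<close>.\<close>
    have "a i \<bullet> x / c i \<in> \<int>" for i
      using xJ x(1) inner_row_int[OF x(1)] by (auto simp: c_def even_on_ker_def)
    moreover have "a i \<bullet> x / c i \<ge> 0" for i using x(2) cpos by (simp add: less_imp_le)
    ultimately have nat: "a i \<bullet> x / c i \<in> \<nat>" for i by (simp add: Nats_altdef2)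
    define K where "K = {i. a i \<bullet> g \<noteq> 0}"
    have "(\<lambda>i. a i \<bullet> x / c i) ` K \<noteq> {}" using g'(2) eq_0_if_orthogonal[of g] by (auto simp: K_def)
    \<comment> \<open>Row \<open>k\<close> is the first to vanish when multiples of \<open>g\<close>
      are subtracted from \<open>x\<close>; as \<open>a k \<bullet> g = c k\<close>, this takes
      exactly the integer quotient as the number of copies.\<close>
    from Min_in[OF _ this] obtain k where k: "k \<in> K" "Min ((\<lambda>i. a i \<bullet> x / c i) ` K) = a k \<bullet> x / c k"
      by auto
    have le: "a k \<bullet> x / c k \<le> a i \<bullet> x / c i" if "i \<in> K" for i using that by (simp flip: k(2))
    obtain n :: nat where n: "a k \<bullet> x / c k = real n" using nat[of k] by (auto elim: Nats_cases)
    define x' where "x' = x - real n *\<^sub>R g"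
    have x'_ge: "a i \<bullet> x' \<ge> 0" for i
    proof (cases "i \<in> K")
      case True
      then have "a i \<bullet> g = c i" using g(3)[of i] by (auto simp: K_def)
      moreover have "real n * c i \<le> a i \<bullet> x"
        using le[OF True] cpos(1)[of i] unfolding n by (simp add: pos_le_divide_eq)
      ultimately show ?thesis by (simp add: x'_def inner_diff_right)
    next
      case False
      then show ?thesis using x(2) by (simp add: K_def x'_def inner_diff_right)
    qed
    have "int_vec x'"
      using g'(1) x(1) unfolding x'_def points_def by (auto intro!: int_vec_diff int_vec_scaleR)
    with x'_ge have x': "x' \<in> points" by (simp add: points_def)
    have gk: "a k \<bullet> g = c k" using k(1) g(3)[of k] by (auto simp: K_def)
    have "a k \<bullet> x' = 0"
      using n cpos(1)[of k] by (simp add: x'_def inner_diff_right gk field_simps)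
    define J' where "J' = {i. a i \<bullet> x' = 0}"
    have "J \<subseteq> J'" using g(2) by (auto simp: J_def J'_def x'_def ker_def inner_diff_right)
    then have "ker J' \<subseteq> ker J" by (auto simp: ker_def)
    moreover have "g \<notin> ker J'" using gk cpos(1)[of k] \<open>a k \<bullet> x' = 0\<close> by (auto simp: ker_def J'_def)
    ultimately have "ker J' \<subset> ker J" using g(2) by blast
    then have dim: "dim (ker J') < dim (ker J)"
      by (intro dim_psubset) (simp add: span_eq_iff[THEN iffD2, OF subspace_ker])
    from less.hyps[OF _ x'] dim obtain S d where S: "S \<subseteq> bounded_atoms" "finite S"
      "card S \<le> dim (ker J')" "x' = (\<Sum>g\<in>S. real (d g) *\<^sub>R g)"
      unfolding J_def J'_def by blast
    \<comment> \<open>\<open>g\<close> may already occur in \<open>S\<close>; its two multiplicities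
      are then added.\<close>
    define d' where "d' = d(g := n + (if g \<in> S then d g else 0))"
    have "(\<Sum>h\<in>insert g S. real (d' h) *\<^sub>R h) = real (d' g) *\<^sub>R g + (\<Sum>h\<in>S - {g}. real (d' h) *\<^sub>R h)"
      using S(2) by (simp add: sum.insert_remove)
    also have "(\<Sum>h\<in>S - {g}. real (d' h) *\<^sub>R h) = (\<Sum>h\<in>S - {g}. real (d h) *\<^sub>R h)"
      by (intro sum.cong) (auto simp: d'_def)
    also have "\<dots> = x' - (if g \<in> S then real (d g) *\<^sub>R g else 0)"
      using S(2) by (auto simp: S(4) sum_diff1)
    also have "real (d' g) *\<^sub>R g + (x' - (if g \<in> S then real (d g) *\<^sub>R g else 0)) = x"
      by (simp add: d'_def x'_def scaleR_add_left)
    finally have "x = (\<Sum>h\<in>insert g S. real (d' h) *\<^sub>R h)" by simp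
    moreover have "card (insert g S) \<le> dim (ker J)"
      using card_insert_le_m1[of "dim (ker J)" S g] S(3) dim by linarith
    moreover have "a i \<bullet> g \<le> 2" for i using g(3)[of i] cpos(2)[of i] by auto
    then have "insert g S \<subseteq> bounded_atoms" using S(1) g(1) by (simp add: bounded_atoms_def)
    ultimately show ?thesis using S(2) unfolding J_def
      by (intro exI[of _ "insert g S"] exI[of _ d']) simp
  qed
qed

end

section \<open>The Hilbert basis and the two bounds for the rank\<close>

context row_system
begin

lemma points_sum:
  assumes "finite H" "H \<subseteq> points"
  shows "(\<Sum>h\<in>H. real (c h) *\<^sub>R h) \<in> points"
  using assms
proof (induction H)
  case (insert h H)
  then have "real (c h) *\<^sub>R h \<in> points" by (auto simp: points_def int_vec_scaleR)
  with insert show ?case by (simp add: points_add)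
qed (simp add: points_0)

text \<open>Splitting off one copy of a nonzero summand \<open>h\<close> leaves a point that
  irreducibility forces to be 0; hence \<open>g = h\<close>.\<close>

lemma atom_mem_if_sum:
  assumes g: "g \<in> atoms" and H: "finite H" "H \<subseteq> points" and eq: "g = (\<Sum>h\<in>H. real (c h) *\<^sub>R h)"
  shows "g \<in> H"
proof -
  have "g \<noteq> 0" using g by (simp add: atoms_def)
  then obtain h where h: "h \<in> H" "c h \<noteq> 0" "h \<noteq> 0"
    unfolding eq by (metis (no_types, lifting) of_nat_0 scaleR_eq_0_iff sum.neutral)
  define d where "d = c(h := c h - 1)"
  have "g = real (c h) *\<^sub>R h + (\<Sum>h\<in>H - {h}. real (c h) *\<^sub>R h)"
    unfolding eq using H(1) h(1) by (rule sum.remove)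
  also have "(\<Sum>h\<in>H - {h}. real (c h) *\<^sub>R h) = (\<Sum>h\<in>H - {h}. real (d h) *\<^sub>R h)"
    by (intro sum.cong) (auto simp: d_def)
  also have "real (c h) *\<^sub>R h = h + real (d h) *\<^sub>R h"
    using h(2) by (simp add: d_def of_nat_diff algebra_simps)
  finally have "g = h + (real (d h) *\<^sub>R h + (\<Sum>h\<in>H - {h}. real (d h) *\<^sub>R h))"
    by (simp add: add.assoc)
  then have gh: "g = h + (\<Sum>h\<in>H. real (d h) *\<^sub>R h)"
    using sum.remove[OF H(1) h(1), of "\<lambda>h. real (d h) *\<^sub>R h"] by simp
  moreover have "h \<in> points" "(\<Sum>h\<in>H. real (d h) *\<^sub>R h) \<in> points"
    using h(1) H by (auto intro: points_sum)
  ultimately have "(\<Sum>h\<in>H. real (d h) *\<^sub>R h) = 0" using g h(3) by (auto simp: atoms_def)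
  with gh h(1) show ?thesis by simp
qed

text \<open>A full-dimensional cone contains arbitrarily large balls, hence integer points
  \<open>z\<close> and \<open>z + axis k 1\<close> for any chosen \<open>k\<close>. If
  \<open>w $ k\<close> is nonzero, \<open>w\<close> cannot vanish at both.\<close>

lemma points_separate:
  assumes "aff_dim {x. \<forall>i. 0 \<le> a i \<bullet> x} = int CARD('n)" and "w \<noteq> 0"
  shows "\<exists>x\<in>points. w \<bullet> x \<noteq> 0"
proof -
  define C where "C = {x. \<forall>i. 0 \<le> a i \<bullet> x}"
  have "convex C"
    unfolding C_def convex_alt by (auto simp: inner_add_right)
  moreover have "0 \<in> C" by (simp add: C_def)
  ultimately have "rel_interior C \<noteq> {}" using rel_interior_eq_empty by blast
  then have "interior C \<noteq> {}"
    using assms(1) interior_rel_interior_gen[of C] by (simp add: C_def)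
  then obtain y \<epsilon> where y: "\<epsilon> > 0" "ball y \<epsilon> \<subseteq> C" by (meson ex_in_conv mem_interior)
  \<comment> \<open>Rounding costs at most \<open>CARD('n)\<close> in norm, and the step along an
    axis one more.\<close>
  obtain N :: nat where N: "real CARD('n) + 1 < real N * \<epsilon>"
    using y(1) reals_Archimedean3 by blast
  then have "N > 0" by (cases "N = 0") auto
  have near: "q \<in> points" if q: "int_vec q" "norm (q - real N *\<^sub>R y) \<le> real CARD('n) + 1" for q
  proof -
    have "q - real N *\<^sub>R y = real N *\<^sub>R ((1 / real N) *\<^sub>R q - y)"
      using \<open>N > 0\<close> by (simp add: scaleR_diff_right)
    then have "real N * norm ((1 / real N) *\<^sub>R q - y) = norm (q - real N *\<^sub>R y)" by simp
    also have "\<dots> < real N * \<epsilon>" using q(2) N by simp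
    finally have "norm ((1 / real N) *\<^sub>R q - y) < \<epsilon>" using \<open>N > 0\<close> by simp
    then have "(1 / real N) *\<^sub>R q \<in> ball y \<epsilon>" by (simp add: dist_norm norm_minus_commute)
    then have "(1 / real N) *\<^sub>R q \<in> C" using y(2) by blast
    then show ?thesis using q(1) \<open>N > 0\<close> by (simp add: C_def points_def zero_le_divide_iff)
  qed
  define z :: "real ^ 'n" where "z = (\<chi> k. of_int \<lfloor>real N * y $ k\<rfloor>)"
  have "norm (z - real N *\<^sub>R y) \<le> (\<Sum>k\<in>UNIV. \<bar>(z - real N *\<^sub>R y) $ k\<bar>)" by (rule norm_le_l1_cart)
  also have "\<dots> \<le> (\<Sum>k\<in>(UNIV :: 'n set). 1)"
  proof (rule sum_mono)
    fix k
    show "\<bar>(z - real N *\<^sub>R y) $ k\<bar> \<le> 1" by (simp add: z_def) linarith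
  qed
  finally have norm_z: "norm (z - real N *\<^sub>R y) \<le> real CARD('n)" by simp
  have "int_vec z" by (simp add: int_vec_def z_def)
  with near norm_z have z: "z \<in> points" by simp
  obtain k where k: "w $ k \<noteq> 0" using assms(2) by (auto simp: vec_eq_iff)
  have "norm (z + axis k 1 - real N *\<^sub>R y) \<le> norm (z - real N *\<^sub>R y) + norm (axis k 1 :: real ^ 'n)"
    using norm_triangle_ineq[of "z - real N *\<^sub>R y" "axis k 1"] by (simp add: algebra_simps)
  then have "norm (z + axis k 1 - real N *\<^sub>R y) \<le> real CARD('n) + 1" using norm_z by simp
  moreover have "int_vec (z + axis k 1)"
    using \<open>int_vec z\<close> by (intro int_vec_add) (auto simp: int_vec_def axis_def)
  ultimately have "z + axis k 1 \<in> points" by (intro near)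
  moreover have "w \<bullet> (z + axis k 1) = w \<bullet> z + w $ k" by (simp add: inner_add_right inner_axis)
  ultimately show ?thesis using z k by (metis add_cancel_right_right)
qed

end

context bimodular
begin

text \<open>By full column rank a point is determined by its row values, which here are integers
  from 0 to 2.\<close>

lemma finite_bounded_atoms: "finite bounded_atoms"
proof -
  define F where "F g = (\<lambda>i. \<lfloor>a i \<bullet> g\<rfloor>)" for g :: "real ^ 'n"
  have Fa: "real_of_int (F g i) = a i \<bullet> g" if "g \<in> points" for g i
    using that inner_row_int[of g i] by (auto simp: F_def points_def elim: Ints_cases)
  have pts: "bounded_atoms \<subseteq> points" by (auto simp: bounded_atoms_def atoms_def)
  have "inj_on F bounded_atoms"
  proof (rule inj_onI)
    fix g h assume gh: "g \<in> bounded_atoms" "h \<in> bounded_atoms" "F g = F h"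
    then have "g \<in> points" "h \<in> points" using pts by blast+
    then have "a i \<bullet> (g - h) = 0" for i
      using Fa[of g i] Fa[of h i] gh(3) by (simp add: inner_diff_right)
    then have "g - h = 0" by (rule eq_0_if_orthogonal)
    then show "g = h" by simp
  qed
  moreover have "F ` bounded_atoms \<subseteq> PiE UNIV (\<lambda>_. {0..2})"
  proof
    fix f assume "f \<in> F ` bounded_atoms"
    then obtain g where g: "g \<in> bounded_atoms" "f = F g" by blast
    have "0 \<le> \<lfloor>a i \<bullet> g\<rfloor> \<and> \<lfloor>a i \<bullet> g\<rfloor> \<le> 2" for i
    proof -
      have "0 \<le> a i \<bullet> g" "a i \<bullet> g \<le> 2"
        using g(1) by (auto simp: bounded_atoms_def atoms_def points_def)
      then show ?thesis by linarith
    qed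
    then show "f \<in> PiE UNIV (\<lambda>_. {0..2})" by (auto simp: g(2) F_def)
  qed
  moreover have "finite (PiE (UNIV :: 'm set) (\<lambda>_. {0..2 :: int}))" by (intro finite_PiE) auto
  ultimately show ?thesis by (meson finite_subset inj_on_finite)
qed

text \<open>An irreducible point must occur among the summands of its own decomposition, and these
  are bounded.\<close>

lemma bounded_atoms_eq: "bounded_atoms = atoms"
proof
  show "atoms \<subseteq> bounded_atoms"
  proof
    fix g assume g: "g \<in> atoms"
    then have "g \<in> points" by (simp add: atoms_def)
    from decomposition[OF this] obtain S c where
      S: "S \<subseteq> bounded_atoms" "finite S" "g = (\<Sum>h\<in>S. real (c h) *\<^sub>R h)" by blast
    have "S \<subseteq> points" using S(1) by (auto simp: bounded_atoms_def atoms_def)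
    from atom_mem_if_sum[OF g S(2) this S(3)] S(1) show "g \<in> bounded_atoms" by blast
  qed
qed (auto simp: bounded_atoms_def)

text \<open>The irreducible points generate by \<open>decomposition\<close> and, by
  \<open>atom_mem_if_sum\<close>, lie in every generating set; so they form the least one.\<close>

lemma hilbert_basis_eq:
  assumes C: "int_points C = points"
  shows "hilbert_basis C = atoms"
proof -
  have fin: "finite atoms" using finite_bounded_atoms by (simp add: bounded_atoms_eq)
  have gen: "generates atoms C"
    unfolding generates_def C
  proof (intro conjI ballI fin)
    show "atoms \<subseteq> points" by (auto simp: atoms_def)
    fix x assume "x \<in> points"
    from decomposition[OF this] obtain S c where
      S: "S \<subseteq> atoms" "x = (\<Sum>h\<in>S. real (c h) *\<^sub>R h)" by (auto simp: bounded_atoms_eq)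
    define d where "d h = (if h \<in> S then c h else 0)" for h
    have "x = (\<Sum>h\<in>atoms. real (d h) *\<^sub>R h)"
      unfolding S(2) using S(1) fin by (intro sum.mono_neutral_cong_left) (auto simp: d_def)
    then show "\<exists>c. x = (\<Sum>h\<in>atoms. real (c h) *\<^sub>R h)" by blast
  qed
  have least: "atoms \<subseteq> H" if H: "generates H C" for H
  proof
    fix g assume g: "g \<in> atoms"
    then have "g \<in> points" by (simp add: atoms_def)
    with H obtain c where c: "g = (\<Sum>h\<in>H. real (c h) *\<^sub>R h)" by (auto simp: generates_def C)
    have "finite H" "H \<subseteq> points" using H by (auto simp: generates_def C)
    from atom_mem_if_sum[OF g this c] show "g \<in> H" .
  qed
  show ?thesis
    unfolding hilbert_basis_def
  proof (rule the_equality)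
    show "generates atoms C \<and> (\<forall>H'. generates H' C \<longrightarrow> H' \<subseteq> atoms \<longrightarrow> H' = atoms)"
      using gen least by blast
    show "H = atoms" if "generates H C \<and> (\<forall>H'. generates H' C \<longrightarrow> H' \<subseteq> H \<longrightarrow> H' = H)" for H
      using that gen least by blast
  qed
qed

text \<open>The upper bound is \<open>decomposition\<close>. For the lower bound, some integer point
  lies outside the spans of all sets of fewer than \<open>CARD('n)\<close> irreducible points, since
  by \<open>sep\<close> no hyperplane through 0 contains all of \<open>points\<close>.\<close>

lemma caratheodory_rank_eq:
  assumes C: "int_points C = points" and sep: "\<And>w. w \<noteq> 0 \<Longrightarrow> \<exists>x\<in>points. w \<bullet> x \<noteq> 0"
  shows "caratheodory_rank C = CARD('n)"
proof -
  note H = hilbert_basis_eq[OF C]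
  define rep where "rep x l \<longleftrightarrow> (\<exists>(h :: nat \<Rightarrow> real ^ 'n) (c :: nat \<Rightarrow> nat).
    (\<forall>i<l. h i \<in> atoms) \<and> x = (\<Sum>i<l. real (c i) *\<^sub>R h i))" for x l
  have len: "hilbert_length C x = (LEAST l. rep x l)" for x
    by (simp add: hilbert_length_def rep_def H)
  have short: "\<exists>l\<le>CARD('n). rep x l" if "x \<in> points" for x
  proof -
    from decomposition[OF that] obtain S c where S: "S \<subseteq> atoms" "finite S"
      "card S \<le> dim (ker {i. a i \<bullet> x = 0})" "x = (\<Sum>g\<in>S. real (c g) *\<^sub>R g)"
      by (auto simp: bounded_atoms_eq)
    obtain h where h: "bij_betw h {..<card S} S"
      using ex_bij_betw_nat_finite[OF S(2)] by (auto simp: lessThan_atLeast0)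
    have "x = (\<Sum>i<card S. real (c (h i)) *\<^sub>R h i)"
      unfolding S(4) by (rule sum.reindex_bij_betw[OF h, symmetric])
    moreover have "h i \<in> atoms" if "i < card S" for i
      using h S(1) that by (auto simp: bij_betw_def)
    ultimately have "rep x (card S)"
      unfolding rep_def by (intro exI[of _ h] exI[of _ "\<lambda>i. c (h i)"]) simp
    moreover have "card S \<le> CARD('n)"
      using S(3) dim_subset_UNIV[of "ker {i. a i \<bullet> x = 0}"] by simp
    ultimately show ?thesis by blast
  qed
  have le: "hilbert_length C x \<le> CARD('n)" if "x \<in> points" for x
    using short[OF that] unfolding len by (meson Least_le le_trans)
  have rep_len: "rep x (hilbert_length C x)" if "x \<in> points" for x
    using short[OF that] unfolding len by (meson LeastI)
  define \<T> where "\<T> = {T. T \<subseteq> atoms \<and> card T < CARD('n)}"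
  have fin: "finite atoms" using finite_bounded_atoms by (simp add: bounded_atoms_eq)
  have "\<exists>w. w \<noteq> 0 \<and> (\<forall>x\<in>span T. w \<bullet> x = 0)" if "T \<in> \<T>" for T
  proof (rule span_not_UNIV_orthogonal)
    have "finite T" "card T < CARD('n)" using that fin by (auto simp: \<T>_def intro: finite_subset)
    then have "dim T < CARD('n)" using dim_le_card' by (meson le_less_trans)
    then show "span T \<noteq> UNIV" by (metis dim_span dim_UNIV DIM_cart DIM_real mult.right_neutral nat_neq_iff)
  qed
  \<comment> \<open>Each span is enclosed in a hyperplane with normal vector \<open>w T\<close>;
    these are finitely many, so \<open>generic_element\<close> can avoid all of them.\<close>
  then obtain w where w: "\<And>T. T \<in> \<T> \<Longrightarrow> w T \<noteq> 0" "\<And>T x. T \<in> \<T> \<Longrightarrow> x \<in> span T \<Longrightarrow> w T \<bullet> x = 0"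
    by metis
  obtain x where x: "x \<in> points" "\<And>T. T \<in> \<T> \<Longrightarrow> w T \<bullet> x \<noteq> 0"
  proof (rule generic_element[of points "w ` \<T>"])
    show "points \<noteq> {}" using points_0 by blast
    show "finite (w ` \<T>)" using fin by (simp add: \<T>_def)
  qed (use points_add sep w(1) in auto)
  have "CARD('n) \<le> hilbert_length C x"
  proof (rule ccontr)
    assume "\<not> CARD('n) \<le> hilbert_length C x"
    then have l: "hilbert_length C x < CARD('n)" by simp
    obtain h c where h: "\<And>i. i < hilbert_length C x \<Longrightarrow> h i \<in> atoms"
      "x = (\<Sum>i<hilbert_length C x. real (c i) *\<^sub>R h i)"
      using rep_len[OF x(1)] unfolding rep_def by blast
    let ?T = "h ` {..<hilbert_length C x}"
    have "card ?T \<le> hilbert_length C x" using card_image_le[of "{..<hilbert_length C x}" h] by simp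
    with l h(1) have "?T \<in> \<T>" by (auto simp: \<T>_def)
    moreover have "x \<in> span ?T"
      by (subst h(2)) (intro span_sum span_scale span_base, simp)
    ultimately show False using w(2) x(2) by blast
  qed
  with le[OF x(1)] have "hilbert_length C x = CARD('n)" by simp
  then show ?thesis
    unfolding caratheodory_rank_def C
  proof (intro Max_eqI)
    show "finite (hilbert_length C ` points)"
      by (rule finite_subset[of _ "{..CARD('n)}"]) (use le in auto)
    show "l \<le> CARD('n)" if "l \<in> hilbert_length C ` points" for l using that le by auto
    show "CARD('n) \<in> hilbert_length C ` points"
      using x(1) \<open>hilbert_length C x = CARD('n)\<close> by (metis imageI)
  qed
qed

end

section \<open>From the integer matrix to its real rows\<close>

lemma of_int_det:
  fixes M :: "int ^ 'n ^ 'n"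
  shows "real_of_int (det M) = det (\<chi> i j. real_of_int (M $ i $ j))"
  by (simp add: det_def of_int_sum of_int_prod)

lemma bimodular_rows:
  fixes A :: "int ^ 'n ^ 'm"
  assumes "full_column_rank A" and "Delta A \<le> 2"
  shows "bimodular (\<lambda>i. real_matrix A $ i)"
proof
  show "y = 0" if "\<And>i. real_matrix A $ i \<bullet> y = 0" for y
  proof -
    have "real_matrix A *v y = 0" using that by (simp add: vec_eq_iff matrix_vector_mul_component)
    moreover have "inj ((*v) (real_matrix A))"
      using assms(1) by (simp add: full_column_rank_def full_rank_injective)
    ultimately show ?thesis by (metis injD matrix_vector_mult_0_right)
  qed
  show "int_vec (real_matrix A $ i)" for i by (simp add: int_vec_def real_matrix_def)
  fix r :: "'n \<Rightarrow> 'm" assume "inj r"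
  let ?D = "{\<bar>det (\<chi> i j. A $ r i $ j)\<bar> | r :: 'n \<Rightarrow> 'm. inj r}"
  have "finite ?D"
    by (rule finite_subset[of _ "range (\<lambda>r :: 'n \<Rightarrow> 'm. \<bar>det (\<chi> i j. A $ r i $ j)\<bar>)"]) auto
  then have "\<bar>det (\<chi> i j. A $ r i $ j)\<bar> \<le> Delta A"
    unfolding Delta_def using \<open>inj r\<close> by (intro Max_ge) auto
  then have "real_of_int \<bar>det (\<chi> i j. A $ r i $ j)\<bar> \<le> 2" using assms(2) by linarith
  moreover have "real_of_int (det (\<chi> i j. A $ r i $ j)) = det (\<chi> k. real_matrix A $ r k)"
    unfolding of_int_det by (intro arg_cong[of _ _ det]) (simp add: vec_eq_iff real_matrix_def)
  ultimately show "\<bar>det (\<chi> k. real_matrix A $ r k)\<bar> \<le> 2" by simp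
qed

theorem theorem3:
  fixes A :: "int ^ 'n ^ 'm"
  assumes "full_column_rank A"
    and "Delta A \<le> 2"
    and "aff_dim (matrix_cone A) = int CARD('n)"
  shows "caratheodory_rank (matrix_cone A) = CARD('n)"
proof -
  interpret bimodular "\<lambda>i. real_matrix A $ i"
    using assms(1,2) by (rule bimodular_rows)
  have cone: "matrix_cone A = {x. \<forall>i. 0 \<le> real_matrix A $ i \<bullet> x}"
    by (simp add: matrix_cone_def matrix_vector_mul_component)
  show ?thesis
  proof (rule caratheodory_rank_eq)
    show "int_points (matrix_cone A) = points"
      by (auto simp: int_points_def points_def cone int_vec_def)
    show "\<exists>x\<in>points. w \<bullet> x \<noteq> 0" if "w \<noteq> 0" for w
      using points_separate[OF assms(3)[unfolded cone] that] .
  qed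
qed

end
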